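(* Let $n\ge2$ and let $\mathcal{F}$ be a family of perfect matchings of $K_{2n}$ such that for any two members $x,y\in\mathcal{F}$ the multigraph on $[2n]$ with edge multiset $x\cup y$ is disconnected. Then $|\mathcal{F}|=(2(n-1)-1)!!$ if and only if $\mathcal{F}=\mathcal{F}_{ij}$ for some distinct $i,j\in[2n]$, where $\mathcal{F}_{ij}$ is the family of all perfect matchings of $K_{2n}$ containing the edge $\{i,j\}$.
   Context: $k!!$ denotes the double factorial. The union $x\cup y$ is a multiset union; it is connected iff it is a Hamiltonian cycle of $K_{2n}$. It is known that such families have size at most $(2(n-1)-1)!!$. *)

theory Defs
  imports
    "Graph_Theory.Digraph_Component"
    "HOL-Library.Multiset"
    "HOL-Library.Disjoint_Sets"
begin

fun double_fact :: "nat \<Rightarrow> nat" where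
  "double_fact 0 = 1"
| "double_fact (Suc 0) = 1"
| "double_fact (Suc (Suc k)) = Suc (Suc k) * double_fact k"

definition complete_edges :: "'a set \<Rightarrow> 'a set set" where
  "complete_edges V = {e. e \<subseteq> V \<and> card e = 2}"

definition perfect_matchings :: "'a set \<Rightarrow> 'a set set \<Rightarrow> 'a set set set" where
  "perfect_matchings V E = {M. M \<subseteq> E \<and> disjoint M \<and> \<Union>M = V}"

abbreviation perfect_matchings_K :: "nat \<Rightarrow> nat set set set" where
  "perfect_matchings_K m \<equiv> perfect_matchings {1..m} (complete_edges {1..m})"

(* The undirected multigraph with vertex set V and edge multiset E, as a
   symmetric digraph: every copy k of an edge {u, v} becomes the two arcs
   ((u, v), k) and ((v, u), k). *)
definition multigraph :: "'a set \<Rightarrow> 'a set multiset \<Rightarrow> ('a, ('a \<times> 'a) \<times> nat) pre_digraph" where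
  "multigraph V E =
     \<lparr> verts = V, arcs = {((u, v), k). k < count E {u, v}},
       tail = (\<lambda>a. fst (fst a)), head = (\<lambda>a. snd (fst a)) \<rparr>"

(* The multiset union adds multiplicities (so it is the sum of multisets, not
   the pointwise maximum): an edge in both x and y becomes a double edge. *)
definition matching_union :: "nat \<Rightarrow> nat set set \<Rightarrow> nat set set \<Rightarrow> (nat, (nat \<times> nat) \<times> nat) pre_digraph" where
  "matching_union n x y = multigraph {1..2 * n} (mset_set x + mset_set y)"

definition matchings_through :: "nat \<Rightarrow> nat \<Rightarrow> nat \<Rightarrow> nat set set set" where
  "matchings_through n i j = {M \<in> perfect_matchings_K (2 * n). {i, j} \<in> M}"

end

theory Submission
  imports Defs "HOL-Combinatorics.Permutations"
begin

text \<open>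
  A perfect matching is handled as a fixpoint-free involution. Let \<open>A\<close> be the adjacency operator of
  the relation that the union is a Hamiltonian cycle on matchings. Contracting an edge \<open>{a, b}\<close> of
  \<open>p\<close> gives the recursion \<open>(A\<^sub>n f)(p) = (A\<^sub>n\<^sub>-\<^sub>1 (J f))(p - {a, b})\<close>, where
  \<open>J f\<close> sums \<open>f\<close> over the matchings obtained by switching the edge at \<open>a\<close>. Splitting \<open>f\<close> into its
  averages over the cells \<open>p a = b\<close>, on which \<open>J\<close> acts as \<open>- 1\<close>, and a remainder, on which
  \<open>- (n - 1) \<le> J \<le> 2 n - 4\<close>, one gets by induction that \<open>A\<close> has norm
  \<open>c = (2 n - 4)!!\<close> on the functions with sum zero. This is the ratio bound: for a
  family of size \<open>(2 n - 3)!!\<close> without Hamiltonian pairs the centred indicator \<open>f\<close>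
  satisfies \<open>A f = - c f\<close>, and equality in the norm estimates forces
  \<open>J = 2 n - 4\<close> on the remainder for every vertex \<open>a\<close>. So the number of members of the family among
  the switches of \<open>p\<close> at \<open>a\<close> depends only on whether \<open>p\<close> is a member and on the number
  of members through the edge of \<open>p\<close> at \<open>a\<close>. If no star lies inside the family and \<open>n \<ge> 3\<close>,
  these counts force all members to coincide, which is absurd.
\<close>

section \<open>Pairings and switches\<close>

text \<open>The induction closes because two constants coincide. On the cell averages
  \<open>J\<close> is \<open>- 1\<close> and the smaller operator multiplies constants by its degree
  \<open>(2 n - 4)!!\<close>; on the remainder \<open>J\<close> has norm at most
  \<open>2 n - 4\<close> and the smaller operator at most \<open>(2 n - 6)!!\<close>. Both products
  equal \<open>c\<close>. The lower end of the spectrum of \<open>J\<close> is harmless only while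
  \<open>n - 1 \<le> 2 n - 4\<close>, that is \<open>n \<ge> 3\<close>. At \<open>n = 3\<close> both
  ends have modulus 2, so equality of norms does not reveal the sign of \<open>J\<close>; that case
  is read off from four vertices, where \<open>A\<close> is \<open>- 1\<close> on functions with sum
  zero.

  The hard estimate is the upper one for \<open>J\<close>. Conditioning on a further edge
  \<open>{k, l}\<close> reduces it to \<open>n - 1\<close>, but the conditioned functions no longer
  have zero cell sums, so the inductive bound covers only their deviations. The loss is governed by
  the means of \<open>f\<close> over the pairings through an edge and is recovered by test functions
  built from these means.

  The degree is \<open>(2 n - 2) c\<close>, so the ratio bound allows the fraction
  \<open>1 / (2 n - 1)\<close> of all \<open>(2 n - 1)!!\<close> matchings.\<close>

definition pairings :: "'a set \<Rightarrow> ('a \<Rightarrow> 'a) set" where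
  "pairings V = {p. (\<forall>v. v \<notin> V \<longrightarrow> p v = v) \<and> (\<forall>v\<in>V. p v \<in> V \<and> p v \<noteq> v \<and> p (p v) = v)}"

text \<open>Exchanges the partners of \<open>a\<close> and \<open>i\<close>: the edges
  \<open>{a, b}\<close>, \<open>{i, j}\<close> become \<open>{a, j}\<close>, \<open>{i, b}\<close>.
  As a conjugation it is an involution in \<open>p\<close> for fixed \<open>a\<close> and
  \<open>i\<close>, so sums can be reindexed along it. For \<open>i = p a\<close> nothing changes,
  hence a sum over all \<open>i \<noteq> a\<close> counts \<open>p\<close> itself once.\<close>

definition conj_swap :: "'a \<Rightarrow> 'a \<Rightarrow> ('a \<Rightarrow> 'a) \<Rightarrow> 'a \<Rightarrow> 'a" where
  "conj_swap a i p = transpose a i \<circ> p \<circ> transpose a i"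

lemma pairings_involutive: "p \<in> pairings V \<Longrightarrow> p (p v) = v"
  unfolding pairings_def by (cases "v \<in> V") auto

lemma pairings_in [simp]: "p \<in> pairings V \<Longrightarrow> p v \<in> V \<longleftrightarrow> v \<in> V"
  unfolding pairings_def by (cases "v \<in> V") auto

lemma pairings_neq: "p \<in> pairings V \<Longrightarrow> v \<in> V \<Longrightarrow> p v \<noteq> v"
  unfolding pairings_def by auto

lemma pairings_out: "p \<in> pairings V \<Longrightarrow> v \<notin> V \<Longrightarrow> p v = v"
  unfolding pairings_def by auto

lemma pairings_eq_iff: "p \<in> pairings V \<Longrightarrow> p u = p v \<longleftrightarrow> u = v"
  by (metis pairings_involutive)

lemma pairings_flip: "p \<in> pairings V \<Longrightarrow> p u = v \<longleftrightarrow> p v = u"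
  by (metis pairings_involutive)

lemma pairings_permutes: "p \<in> pairings V \<Longrightarrow> p permutes V"
  unfolding permutes_def by (metis pairings_involutive pairings_out)

lemma finite_pairings:
  assumes "finite V" shows "finite (pairings V)"
  by (rule finite_subset[OF _ finite_permutations[OF assms]]) (auto intro: pairings_permutes)

lemma conj_swap_apply:
  assumes p: "p \<in> pairings V" and "a \<in> V" "i \<in> V"
  shows "conj_swap a i p v = (if p a = i \<or> a = i then p v
     else if v = a then p i else if v = i then p a
     else if v = p a then i else if v = p i then a else p v)"
proof -
  define b j where "b = p a" and "j = p i"
  have *: "p a = b" "p b = a" "p i = j" "p j = i" "b \<noteq> a" "j \<noteq> i"
    using assms pairings_neq[OF p] pairings_involutive[OF p] by (simp_all add: b_def j_def)
  show ?thesis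
  proof (cases "v \<in> {a, b, i, j}")
    case True
    then show ?thesis
      using * by (elim insertE emptyE; simp add: conj_swap_def transpose_def; metis)
  next
    case False
    then have "p v \<noteq> a" "p v \<noteq> i" using * by (metis insertCI pairings_involutive[OF p])+
    then show ?thesis using False * by (simp add: conj_swap_def transpose_def)
  qed
qed

lemma conj_swap_in:
  assumes p: "p \<in> pairings V" and "a \<in> V" "i \<in> V"
  shows "conj_swap a i p \<in> pairings V"
proof -
  have in_V: "transpose a i v \<in> V \<longleftrightarrow> v \<in> V" for v
    using assms by (auto simp: transpose_def)
  have "conj_swap a i p v = v" if "v \<notin> V" for v
    using that assms pairings_out[OF p] by (auto simp: conj_swap_def transpose_def)
  moreover have "conj_swap a i p v \<in> V \<and> conj_swap a i p v \<noteq> v" if "v \<in> V" for v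
    using that pairings_neq[OF p, of "transpose a i v"] p in_V
    unfolding conj_swap_def o_def by (metis pairings_in transpose_involutory)
  moreover have "conj_swap a i p (conj_swap a i p v) = v" for v
    unfolding conj_swap_def o_def using pairings_involutive[OF p] by simp
  ultimately show ?thesis unfolding pairings_def by blast
qed

lemma conj_swap_idem [simp]: "conj_swap a i (conj_swap a i p) = p"
  unfolding conj_swap_def by (auto simp: fun_eq_iff)

lemma conj_swap_partner:
  assumes "p \<in> pairings V" "a \<in> V" shows "conj_swap a (p a) p = p"
  using conj_swap_apply[OF assms, of "p a"] assms by (auto simp: fun_eq_iff)

lemma conj_swap_bij:
  assumes "a \<in> V" "i \<in> V" shows "bij_betw (conj_swap a i) (pairings V) (pairings V)"
  by (rule bij_betwI[where g="conj_swap a i"]) (auto intro: conj_swap_in assms)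

text \<open>A pairing of \<open>V - {k, l}\<close> fixes \<open>k\<close> and \<open>l\<close>,
  since pairings are the identity outside their vertex set; composing with the transposition inserts
  the edge \<open>{k, l}\<close>, and composing again removes it. One involution serves both
  directions.\<close>

definition add_edge :: "'a \<Rightarrow> 'a \<Rightarrow> ('a \<Rightarrow> 'a) \<Rightarrow> 'a \<Rightarrow> 'a" where
  "add_edge k l p = p \<circ> transpose k l"

lemma add_edge_idem [simp]: "add_edge k l (add_edge k l p) = p"
  unfolding add_edge_def by (auto simp: fun_eq_iff)

lemma add_edge_in:
  assumes "q \<in> pairings (V - {k,l})" "k \<in> V" "l \<in> V" "k \<noteq> l"
  shows "add_edge k l q \<in> pairings V" "add_edge k l q k = l" "add_edge k l q l = k"
    "v \<noteq> k \<Longrightarrow> v \<noteq> l \<Longrightarrow> add_edge k l q v = q v"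
  using assms unfolding add_edge_def pairings_def o_def transpose_def by auto

lemma remove_edge_in:
  assumes p: "p \<in> pairings V" and "p k = l" "k \<in> V"
  shows "add_edge k l p \<in> pairings (V - {k,l})"
proof -
  have kl: "p k = l" "p l = k" "l \<in> V" using assms pairings_flip[OF p] by auto
  then have out: "add_edge k l p v = (if v \<in> {k,l} then v else p v)" for v
    by (auto simp: add_edge_def transpose_def)
  have "p v \<notin> {k,l}" if "v \<notin> {k,l}" for v
    using that kl pairings_flip[OF p] by auto
  then show ?thesis
    unfolding pairings_def using out p pairings_neq[OF p] pairings_out[OF p] pairings_involutive[OF p] by auto
qed

lemma add_edge_bij:
  assumes "k \<in> V" "l \<in> V" "k \<noteq> l"
  shows "bij_betw (add_edge k l) (pairings (V - {k,l})) {p \<in> pairings V. p k = l}"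
  by (rule bij_betwI[where g="add_edge k l"]) (auto simp: add_edge_in[OF _ assms] intro: remove_edge_in assms)

lemma sum_through:
  fixes f :: "('a \<Rightarrow> 'a) \<Rightarrow> 'b::comm_monoid_add"
  assumes "k \<in> V" "l \<in> V" "k \<noteq> l"
  shows "(\<Sum>p\<in>{p \<in> pairings V. p k = l}. f p) = (\<Sum>q\<in>pairings (V - {k,l}). f (add_edge k l q))"
  by (rule sum.reindex_bij_betw[OF add_edge_bij[OF assms], symmetric])

lemma sum_by_partner:
  fixes f :: "('a \<Rightarrow> 'a) \<Rightarrow> 'b::comm_monoid_add"
  assumes "finite V" "k \<in> V"
  shows "(\<Sum>p\<in>pairings V. f p) = (\<Sum>l\<in>V-{k}. \<Sum>p\<in>{p \<in> pairings V. p k = l}. f p)"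
proof -
  have "(\<lambda>p. p k) ` pairings V \<subseteq> V - {k}"
    using assms pairings_neq by fastforce
  then show ?thesis
    using sum.group[OF finite_pairings[OF assms(1)], of "V-{k}" "\<lambda>p. p k" f] assms by simp
qed

lemma sum_by_edge:
  fixes f :: "('a \<Rightarrow> 'a) \<Rightarrow> 'b::comm_monoid_add"
  assumes "finite V" "k \<in> V"
  shows "(\<Sum>p\<in>pairings V. f p) = (\<Sum>l\<in>V-{k}. \<Sum>q\<in>pairings (V - {k,l}). f (add_edge k l q))"
  unfolding sum_by_partner[OF assms] by (intro sum.cong refl sum_through) (use assms in auto)

section \<open>Counting pairings: \<open>(2 n - 1)!!\<close>\<close>

fun num_pairings :: "nat \<Rightarrow> nat" where
  "num_pairings 0 = 1"
| "num_pairings (Suc n) = (2 * n + 1) * num_pairings n"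

lemma card_pairings:
  "card V = 2 * n \<Longrightarrow> finite V \<Longrightarrow> card (pairings V) = num_pairings n"
proof (induction n arbitrary: V)
  case 0
  then have "pairings V = {id}" by (auto simp: pairings_def)
  then show ?case by simp
next
  case (Suc n)
  then obtain k where k: "k \<in> V" by fastforce
  have "card (pairings V) = (\<Sum>p\<in>pairings V. 1)" by simp
  also have "\<dots> = (\<Sum>l\<in>V-{k}. card (pairings (V - {k,l})))"
    by (subst sum_by_edge[OF _ k]) (use Suc in auto)
  also have "\<dots> = (\<Sum>l\<in>V-{k}. num_pairings n)"
  proof (intro sum.cong refl Suc.IH)
    fix l assume "l \<in> V - {k}"
    then have "card (V - {k,l}) = card V - card {k,l}"
      using k Suc.prems by (intro card_Diff_subset) auto
    then show "card (V - {k,l}) = 2 * n" using \<open>l \<in> V - {k}\<close> Suc.prems by auto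
  qed (use Suc in auto)
  also have "\<dots> = num_pairings (Suc n)" using k Suc by simp
  finally show ?case .
qed

lemma card_through:
  assumes "finite V" "card V = 2 * n" "k \<in> V" "l \<in> V" "k \<noteq> l"
  shows "card {p \<in> pairings V. p k = l} = num_pairings (n - 1)"
proof -
  have "card (V - {k,l}) = card V - card {k,l}"
    using assms by (intro card_Diff_subset) auto
  then have "card (V - {k,l}) = 2 * (n - 1)" using assms by auto
  then have "card (pairings (V - {k,l})) = num_pairings (n - 1)"
    using card_pairings assms by blast
  then show ?thesis using bij_betw_same_card[OF add_edge_bij[OF assms(3-5)]] by simp
qed

lemma add_edge_conj_swap:
  assumes "a \<notin> {k,l}" "i \<notin> {k,l}" 
  shows "add_edge k l (conj_swap a i q) = conj_swap a i (add_edge k l q)"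
proof -
  have "transpose a i (transpose k l v) = transpose k l (transpose a i v)" for v
    using assms by (auto simp: transpose_def)
  then show ?thesis unfolding add_edge_def conj_swap_def by (simp add: fun_eq_iff)
qed

section \<open>Switching the edge at a fixed vertex\<close>

definition ip :: "'a set \<Rightarrow> (('a \<Rightarrow> 'a) \<Rightarrow> real) \<Rightarrow> (('a \<Rightarrow> 'a) \<Rightarrow> real) \<Rightarrow> real" where
  "ip V f g = (\<Sum>p\<in>pairings V. f p * g p)"

definition star :: "'a set \<Rightarrow> 'a \<Rightarrow> (('a \<Rightarrow> 'a) \<Rightarrow> real) \<Rightarrow> ('a \<Rightarrow> 'a) \<Rightarrow> real" where
  "star V a f p = (\<Sum>i\<in>V-{a}. f (conj_swap a i p))"

definition edge_mean :: "'a set \<Rightarrow> (('a \<Rightarrow> 'a) \<Rightarrow> real) \<Rightarrow> 'a \<Rightarrow> 'a \<Rightarrow> real" where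
  "edge_mean V f k l = (\<Sum>p | p \<in> pairings V \<and> p k = l. f p) / card {p \<in> pairings V. p k = l}"

lemma ip_commute: "ip V f g = ip V g f"
  by (simp add: ip_def mult.commute)

lemma ip_add_left: "ip V (\<lambda>p. f p + g p) h = ip V f h + ip V g h"
  by (simp add: ip_def algebra_simps sum.distrib)

lemma ip_diff_left: "ip V (\<lambda>p. f p - g p) h = ip V f h - ip V g h"
  by (simp add: ip_def algebra_simps sum_subtractf)

lemma ip_scale_left: "ip V (\<lambda>p. c * f p) h = c * ip V f h"
  by (simp add: ip_def algebra_simps sum_distrib_left)

lemma ip_add_right: "ip V h (\<lambda>p. f p + g p) = ip V h f + ip V h g"
  by (simp add: ip_def algebra_simps sum.distrib)

lemma ip_diff_right: "ip V h (\<lambda>p. f p - g p) = ip V h f - ip V h g"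
  by (simp add: ip_def algebra_simps sum_subtractf)

lemma ip_scale_right: "ip V h (\<lambda>p. c * f p) = c * ip V h f"
  by (simp add: ip_def algebra_simps sum_distrib_left)

lemmas ip_linear = ip_add_left ip_diff_left ip_scale_left ip_add_right ip_diff_right ip_scale_right

lemma ip_cong:
  "(\<And>p. p \<in> pairings V \<Longrightarrow> f p = f' p) \<Longrightarrow> (\<And>p. p \<in> pairings V \<Longrightarrow> g p = g' p) \<Longrightarrow> ip V f g = ip V f' g'"
  by (simp add: ip_def)

lemma ip_nonneg: "ip V f f \<ge> 0"
  unfolding ip_def by (intro sum_nonneg) auto

lemma ip_eq_0:
  assumes "finite V" "ip V f f = 0" "p \<in> pairings V" shows "f p = 0"
  using assms sum_nonneg_eq_0_iff[OF finite_pairings[OF assms(1)], of "\<lambda>p. f p * f p"]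
  unfolding ip_def by auto

lemma star_add: "star V a (\<lambda>p. f p + g p) p = star V a f p + star V a g p"
  by (simp add: star_def sum.distrib)

lemma star_scale: "star V a (\<lambda>p. c * f p) p = c * star V a f p"
  by (simp add: star_def sum_distrib_left)

lemma star_cong:
  assumes "\<And>p. p \<in> pairings V \<Longrightarrow> f p = g p" "a \<in> V" "p \<in> pairings V"
  shows "star V a f p = star V a g p"
  unfolding star_def by (rule sum.cong[OF refl]) (use conj_swap_in[OF assms(3,2)] assms(1) in blast)

lemma star_selfadj:
  assumes "finite V" "a \<in> V"
  shows "ip V f (star V a g) = ip V (star V a f) g"
proof -
  have "ip V f (star V a g) = (\<Sum>i\<in>V-{a}. \<Sum>p\<in>pairings V. f p * g (conj_swap a i p))"
    unfolding ip_def star_def sum_distrib_left by (rule sum.swap)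
  also have "\<dots> = (\<Sum>i\<in>V-{a}. \<Sum>p\<in>pairings V. f (conj_swap a i p) * g p)"
  proof (rule sum.cong[OF refl])
    fix i assume "i \<in> V - {a}"
    then have "bij_betw (conj_swap a i) (pairings V) (pairings V)"
      by (intro conj_swap_bij assms) auto
    from sum.reindex_bij_betw[OF this, of "\<lambda>p. f p * g (conj_swap a i p)", symmetric]
    show "(\<Sum>p\<in>pairings V. f p * g (conj_swap a i p)) = (\<Sum>p\<in>pairings V. f (conj_swap a i p) * g p)"
      by (simp only: conj_swap_idem)
  qed
  also have "\<dots> = ip V (star V a f) g"
    unfolding ip_def star_def sum_distrib_right by (rule sum.swap)
  finally show ?thesis .
qed

text \<open>Over the switches at \<open>a\<close>, the new partner of \<open>a\<close> takes every
  value in \<open>V - {a}\<close> once: it is \<open>p i\<close> for \<open>i \<noteq> p a\<close>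
  and stays \<open>p a\<close> for \<open>i = p a\<close>. So \<open>star\<close> collapses every
  function of \<open>p a\<close> to a constant, which is why the cells \<open>p a = b\<close> give
  the right decomposition.\<close>

lemma star_partner_fun:
  assumes "p \<in> pairings V" "a \<in> V"
  shows "star V a (\<lambda>q. \<phi> (q a)) p = (\<Sum>b\<in>V-{a}. \<phi> b)"
proof -
  let ?s = "\<lambda>i. if i = p a then i else p i"
  have pa: "p i = a \<longleftrightarrow> i = p a" "p i = p a \<longleftrightarrow> i = a" "p (p i) = i" "p a \<noteq> a" for i
    using assms by (auto simp: pairings_involutive pairings_eq_iff pairings_neq)
  have bij: "bij_betw ?s (V - {a}) (V - {a})"
    by (rule bij_betw_byWitness[where f'="?s"])
      (use assms pa in auto)
  have "star V a (\<lambda>q. \<phi> (q a)) p = (\<Sum>i\<in>V-{a}. \<phi> (?s i))"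
    unfolding star_def by (intro sum.cong refl) (use assms pa in \<open>auto simp: conj_swap_apply[OF assms(1,2)]\<close>)
  also have "\<dots> = (\<Sum>b\<in>V-{a}. \<phi> b)"
    by (rule sum.reindex_bij_betw[OF bij])
  finally show ?thesis .
qed

lemma ip_partner_fun:
  assumes "finite V" "a \<in> V"
  shows "ip V f (\<lambda>p. \<phi> (p a)) = (\<Sum>b\<in>V-{a}. \<phi> b * (\<Sum>p | p \<in> pairings V \<and> p a = b. f p))"
proof -
  have "ip V f (\<lambda>p. \<phi> (p a)) = (\<Sum>b\<in>V-{a}. \<Sum>p | p \<in> pairings V \<and> p a = b. f p * \<phi> (p a))"
    unfolding ip_def by (rule sum_by_partner[OF assms])
  also have "\<dots> = (\<Sum>b\<in>V-{a}. \<phi> b * (\<Sum>p | p \<in> pairings V \<and> p a = b. f p))"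
    by (auto intro!: sum.cong simp: sum_distrib_left)
  finally show ?thesis .
qed

section \<open>Edge means and the splitting into cells\<close>

lemma num_pairings_pos: "num_pairings n > 0"
  by (induction n) simp_all

lemma edge_mean_sum:
  assumes "finite V" "card V = 2 * n" "k \<in> V" "l \<in> V" "k \<noteq> l"
  shows "(\<Sum>p | p \<in> pairings V \<and> p k = l. f p) = num_pairings (n - 1) * edge_mean V f k l"
  using num_pairings_pos[of "n-1"] card_through[OF assms] by (simp add: edge_mean_def)

lemma edge_mean_commute: "edge_mean V f k l = edge_mean V f l k"
proof -
  have "{p \<in> pairings V. p k = l} = {p \<in> pairings V. p l = k}"
    by (intro Collect_cong conj_cong refl) (rule pairings_flip)
  then show ?thesis by (simp add: edge_mean_def)
qed

text \<open>The orthogonal projection of \<open>f\<close> onto the functions of \<open>p a\<close>;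
  \<open>cell_dev\<close> is the complementary part.\<close>

definition cell_avg :: "'a set \<Rightarrow> 'a \<Rightarrow> (('a \<Rightarrow> 'a) \<Rightarrow> real) \<Rightarrow> ('a \<Rightarrow> 'a) \<Rightarrow> real" where
  "cell_avg V a f p = edge_mean V f a (p a)"

definition cell_dev :: "'a set \<Rightarrow> 'a \<Rightarrow> (('a \<Rightarrow> 'a) \<Rightarrow> real) \<Rightarrow> ('a \<Rightarrow> 'a) \<Rightarrow> real" where
  "cell_dev V a f p = f p - cell_avg V a f p"

definition cells_zero :: "'a set \<Rightarrow> 'a \<Rightarrow> (('a \<Rightarrow> 'a) \<Rightarrow> real) \<Rightarrow> bool" where
  "cells_zero V a f \<longleftrightarrow> (\<forall>b\<in>V-{a}. (\<Sum>p | p \<in> pairings V \<and> p a = b. f p) = 0)"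

lemma ip_cells_zero:
  assumes "finite V" "a \<in> V" "cells_zero V a f"
  shows "ip V f (\<lambda>p. \<phi> (p a)) = 0"
  unfolding ip_partner_fun[OF assms(1,2), of f \<phi>]
  by (intro sum.neutral) (use assms(3) in \<open>auto simp: cells_zero_def\<close>)

lemma cells_zero_dev:
  assumes "finite V" "card V = 2 * n" "a \<in> V"
  shows "cells_zero V a (cell_dev V a f)"
  unfolding cells_zero_def
proof
  fix b assume b: "b \<in> V - {a}"
  then have "b \<in> V" "a \<noteq> b" by auto
  note em = edge_mean_sum[OF assms this, of f] and cd = card_through[OF assms this]
  have "(\<Sum>p | p \<in> pairings V \<and> p a = b. cell_dev V a f p)
     = (\<Sum>p | p \<in> pairings V \<and> p a = b. f p - edge_mean V f a b)"
    by (intro sum.cong) (auto simp: cell_dev_def cell_avg_def)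
  also have "\<dots> = 0" by (simp only: sum_subtractf em sum_constant cd)
  finally show "(\<Sum>p | p \<in> pairings V \<and> p a = b. cell_dev V a f p) = 0" .
qed

lemma sum_edge_means:
  assumes "finite V" "card V = 2 * n" "a \<in> V"
  shows "(\<Sum>p\<in>pairings V. f p) = num_pairings (n - 1) * (\<Sum>b\<in>V-{a}. edge_mean V f a b)"
  unfolding sum_by_partner[OF assms(1,3)] sum_distrib_left
  by (intro sum.cong refl edge_mean_sum) (use assms in auto)

lemma cell_split_norm:
  assumes "finite V" "card V = 2 * n" "a \<in> V"
  shows "ip V f f = ip V (cell_dev V a f) (cell_dev V a f) + ip V (cell_avg V a f) (cell_avg V a f)"
proof -
  let ?g = "cell_dev V a f" and ?h = "cell_avg V a f"
  have *: "ip V ?g ?h = 0"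
    using ip_cells_zero[OF assms(1,3) cells_zero_dev[OF assms], where \<phi>="edge_mean V f a"]
    by (simp add: cell_avg_def[abs_def])
  have f: "(\<lambda>p. ?g p + ?h p) = f" by (simp add: cell_dev_def)
  have "ip V f f = ip V (\<lambda>p. ?g p + ?h p) (\<lambda>p. ?g p + ?h p)"
    unfolding f ..
  also have "\<dots> = ip V ?g ?g + 2 * ip V ?g ?h + ip V ?h ?h"
    unfolding ip_add_left ip_add_right ip_commute[of V ?h ?g] by simp
  finally show ?thesis using * by simp
qed

lemma star_cell_avg:
  assumes "finite V" "card V = 2 * n" "a \<in> V" "p \<in> pairings V"
  shows "star V a (cell_avg V a f) p = (\<Sum>q\<in>pairings V. f q) / num_pairings (n - 1)"
  using star_partner_fun[OF assms(4,3), of "edge_mean V f a"] sum_edge_means[OF assms(1-3), of f]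
    num_pairings_pos[of "n-1"]
  by (simp add: cell_avg_def[abs_def])

lemma cells_zero_sum:
  assumes "finite V" "a \<in> V" "cells_zero V a f"
  shows "(\<Sum>p\<in>pairings V. f p) = 0"
  using ip_cells_zero[OF assms, of "\<lambda>_. 1"] by (simp add: ip_def)

text \<open>\<open>star\<close> is self-adjoint and maps functions of \<open>p a\<close> to
  constants, so it preserves the orthogonal complement of the functions of
  \<open>p a\<close>.\<close>

lemma cells_zero_star:
  assumes "finite V" "a \<in> V" "cells_zero V a f"
  shows "cells_zero V a (star V a f)"
  unfolding cells_zero_def
proof
  fix b assume b: "b \<in> V - {a}"
  let ?\<phi> = "\<lambda>c. if c = b then 1 else (0::real)"
  have "(\<Sum>p | p \<in> pairings V \<and> p a = b. star V a f p) = ip V (star V a f) (\<lambda>p. ?\<phi> (p a))"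
    unfolding ip_def sum.inter_filter[OF finite_pairings[OF assms(1)]]
    by (intro sum.cong) auto
  also have "\<dots> = ip V f (star V a (\<lambda>p. ?\<phi> (p a)))"
    by (rule star_selfadj[OF assms(1,2), symmetric])
  also have "\<dots> = ip V f (\<lambda>p. (\<Sum>b\<in>V-{a}. ?\<phi> b))"
    by (intro ip_cong refl star_partner_fun[where \<phi>="?\<phi>"] assms)
  also have "\<dots> = 0" by (rule ip_cells_zero[OF assms, of "\<lambda>_. \<Sum>b\<in>V-{a}. ?\<phi> b"])
  finally show "(\<Sum>p | p \<in> pairings V \<and> p a = b. star V a f p) = 0" .
qed

lemma cells_zero_lin:
  assumes "cells_zero V a f" "cells_zero V a g"
  shows "cells_zero V a (\<lambda>p. c * f p + d * g p)"
  using assms by (simp add: cells_zero_def sum.distrib sum_distrib_left[symmetric])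

text \<open>The average part is mapped to a constant and the deviation is orthogonal to constants,
  so the cross terms vanish; the last summand is that constant times the sum of
  \<open>f\<close>.\<close>

lemma cell_split_star:
  assumes "finite V" "card V = 2 * n" "a \<in> V"
  shows "ip V f (star V a f) = ip V (cell_dev V a f) (star V a (cell_dev V a f))
     + (\<Sum>q\<in>pairings V. f q)\<^sup>2 / num_pairings (n - 1)"
proof -
  let ?g = "cell_dev V a f" and ?h = "cell_avg V a f"
  define c where "c = (\<Sum>q\<in>pairings V. f q) / num_pairings (n - 1)"
  have g: "cells_zero V a ?g" by (rule cells_zero_dev[OF assms])
  have f: "(\<lambda>p. ?g p + ?h p) = f" by (simp add: cell_dev_def)
  have sh: "ip V u (star V a ?h) = c * (\<Sum>p\<in>pairings V. u p)" for u
  proof -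
    have "ip V u (star V a ?h) = ip V u (\<lambda>_. c)"
      unfolding c_def by (intro ip_cong refl star_cell_avg[OF assms])
    then show ?thesis by (simp add: ip_def sum_distrib_left mult.commute)
  qed
  have g0: "(\<Sum>p\<in>pairings V. ?g p) = 0" by (rule cells_zero_sum[OF assms(1,3) g])
  have h: "(\<Sum>p\<in>pairings V. ?h p) = (\<Sum>p\<in>pairings V. f p)"
    using g0 by (simp add: cell_dev_def sum_subtractf)
  have "ip V f (star V a f) = ip V (\<lambda>p. ?g p + ?h p) (star V a (\<lambda>p. ?g p + ?h p))"
    unfolding f ..
  also have "\<dots> = ip V ?g (star V a ?g) + ip V ?g (star V a ?h) + ip V ?h (star V a ?g) + ip V ?h (star V a ?h)"
    by (simp add: star_add[abs_def] ip_linear)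
  also have "ip V ?h (star V a ?g) = ip V ?g (star V a ?h)"
    using star_selfadj[OF assms(1,3)] ip_commute by metis
  finally show ?thesis
    unfolding sh g0 h by (simp add: c_def power2_eq_square)
qed

section \<open>Averaging over a contracted edge\<close>

lemma sum_over_edges:
  fixes F :: "'a \<Rightarrow> 'a \<Rightarrow> ('a \<Rightarrow> 'a) \<Rightarrow> real"
  assumes "finite V" "a \<in> V"
  shows "(\<Sum>k\<in>V-{a}. \<Sum>l\<in>V-{a,k}. \<Sum>p | p \<in> pairings V \<and> p k = l. F k l p)
    = (\<Sum>p\<in>pairings V. \<Sum>k\<in>V-{a,p a}. F k (p k) p)"
proof -
  have "(\<Sum>k\<in>V-{a}. \<Sum>l\<in>V-{a,k}. \<Sum>p | p \<in> pairings V \<and> p k = l. F k l p)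
     = (\<Sum>k\<in>V-{a}. \<Sum>p\<in>pairings V. if p k \<noteq> a then F k (p k) p else 0)"
  proof (rule sum.cong[OF refl])
    fix k assume k: "k \<in> V - {a}"
    have "(\<Sum>l\<in>V-{a,k}. \<Sum>p | p \<in> pairings V \<and> p k = l. F k l p)
       = (\<Sum>l\<in>V-{a,k}. \<Sum>p\<in>pairings V. if p k = l then F k l p else 0)"
      using finite_pairings[OF assms(1)] by (simp add: sum.inter_filter)
    also have "\<dots> = (\<Sum>p\<in>pairings V. \<Sum>l\<in>V-{a,k}. if p k = l then F k l p else 0)"
      by (rule sum.swap)
    also have "\<dots> = (\<Sum>p\<in>pairings V. if p k \<noteq> a then F k (p k) p else 0)"
      using assms(1) k by (intro sum.cong refl) (auto simp: pairings_neq)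
    finally show "(\<Sum>l\<in>V-{a,k}. \<Sum>p | p \<in> pairings V \<and> p k = l. F k l p)
       = (\<Sum>p\<in>pairings V. if p k \<noteq> a then F k (p k) p else 0)" .
  qed
  also have "\<dots> = (\<Sum>p\<in>pairings V. \<Sum>k\<in>V-{a}. if p k \<noteq> a then F k (p k) p else 0)"
    by (rule sum.swap)
  also have "\<dots> = (\<Sum>p\<in>pairings V. \<Sum>k\<in>V-{a,p a}. F k (p k) p)"
  proof (rule sum.cong[OF refl])
    fix p assume p: "p \<in> pairings V"
    have "p k = a \<longleftrightarrow> k = p a" for k using pairings_involutive[OF p] by metis
    then have "{k \<in> V - {a}. p k \<noteq> a} = V - {a, p a}" by auto
    then show "(\<Sum>k\<in>V-{a}. if p k \<noteq> a then F k (p k) p else 0) = (\<Sum>k\<in>V-{a,p a}. F k (p k) p)"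
      using assms(1) by (simp add: sum.inter_filter[symmetric])
  qed
  finally show ?thesis .
qed

text \<open>Double counting of ordered edges \<open>(k, l)\<close> of \<open>p\<close> that avoid
  \<open>a\<close>. The switch at \<open>a\<close> with \<open>i\<close> survives the removal of
  \<open>{k, l}\<close> iff \<open>i\<close> is not an end of it: this leaves \<open>2 n - 4\<close>
  ordered edges for a proper switch, but \<open>2 n - 2\<close> for the trivial one
  \<open>i = p a\<close>. The surplus of 2 is the last summand.\<close>

lemma star_average:
  assumes "finite V" "card V = 2 * n" "a \<in> V" "n \<ge> 2"
  shows "(\<Sum>k\<in>V-{a}. \<Sum>l\<in>V-{a,k}. ip (V-{k,l}) (f \<circ> add_edge k l) (star (V-{k,l}) a (f \<circ> add_edge k l)))
    = (2 * real n - 4) * ip V f (star V a f) + 2 * ip V f f"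
proof -
  have "ip (V-{k,l}) (f \<circ> add_edge k l) (star (V-{k,l}) a (f \<circ> add_edge k l))
     = (\<Sum>p | p \<in> pairings V \<and> p k = l. \<Sum>i\<in>V-{a,k,l}. f p * f (conj_swap a i p))"
    if "k \<in> V - {a}" "l \<in> V - {a,k}" for k l
  proof -
    have "(\<Sum>p | p \<in> pairings V \<and> p k = l. \<Sum>i\<in>V-{a,k,l}. f p * f (conj_swap a i p))
       = (\<Sum>q\<in>pairings (V-{k,l}). \<Sum>i\<in>V-{a,k,l}. f (add_edge k l q) * f (conj_swap a i (add_edge k l q)))"
      by (rule sum_through) (use that in auto)
    also have "\<dots> = (\<Sum>q\<in>pairings (V-{k,l}). \<Sum>i\<in>V-{k,l}-{a}. f (add_edge k l q) * f (add_edge k l (conj_swap a i q)))"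
      using that by (intro sum.cong) (auto simp: add_edge_conj_swap)
    finally show ?thesis by (simp add: ip_def star_def sum_distrib_left)
  qed
  then have "(\<Sum>k\<in>V-{a}. \<Sum>l\<in>V-{a,k}. ip (V-{k,l}) (f \<circ> add_edge k l) (star (V-{k,l}) a (f \<circ> add_edge k l)))
    = (\<Sum>k\<in>V-{a}. \<Sum>l\<in>V-{a,k}. \<Sum>p | p \<in> pairings V \<and> p k = l. \<Sum>i\<in>V-{a,k,l}. f p * f (conj_swap a i p))"
    by simp
  also have "\<dots> = (\<Sum>p\<in>pairings V. \<Sum>k\<in>V-{a,p a}. \<Sum>i\<in>V-{a,k,p k}. f p * f (conj_swap a i p))"
    by (rule sum_over_edges) (use assms in auto)
  also have "\<dots> = (\<Sum>p\<in>pairings V. (2 * real n - 4) * (f p * star V a f p) + 2 * (f p * f p))"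
  proof (rule sum.cong[OF refl])
    fix p assume p: "p \<in> pairings V"
    let ?g = "\<lambda>i. f p * f (conj_swap a i p)"
    have pa: "p a \<in> V" "p a \<noteq> a" using p assms by (auto simp: pairings_neq)
    have crd: "card {k \<in> V - {a, p a}. i \<noteq> k \<and> i \<noteq> p k} = (if i = p a then 2 * n - 2 else 2 * n - 4)"
      if i: "i \<in> V - {a}" for i
    proof (cases "i = p a")
      case True
      then have "{k \<in> V - {a, p a}. i \<noteq> k \<and> i \<noteq> p k} = V - {a, p a}"
        by (auto simp: pairings_eq_iff[OF p])
      then show ?thesis using True pa assms by (simp add: card_Diff_subset)
    next
      case False
      have *: "p i \<in> V" "p i \<noteq> i" "p i \<noteq> a" "p i \<noteq> p a"
        using p i False pairings_neq[OF p] pairings_flip[OF p, of i a] by (auto simp: pairings_eq_iff[OF p])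
      have "i = p k \<longleftrightarrow> k = p i" for k using pairings_involutive[OF p] by metis
      then have "{k \<in> V - {a, p a}. i \<noteq> k \<and> i \<noteq> p k} = V - {a, p a, i, p i}" by auto
      moreover have "card {a, p a, i, p i} = 4" using * pa i False by auto
      ultimately show ?thesis using False pa * i assms by (simp add: card_Diff_subset)
    qed
    have "(\<Sum>k\<in>V-{a,p a}. \<Sum>i\<in>V-{a,k,p k}. ?g i)
       = (\<Sum>k\<in>V-{a,p a}. \<Sum>i\<in>V-{a}. if i \<noteq> k \<and> i \<noteq> p k then ?g i else 0)"
    proof (rule sum.cong[OF refl])
      fix k 
      have "V - {a, k, p k} = {i \<in> V - {a}. i \<noteq> k \<and> i \<noteq> p k}" by auto
      then show "(\<Sum>i\<in>V-{a,k,p k}. ?g i) = (\<Sum>i\<in>V-{a}. if i \<noteq> k \<and> i \<noteq> p k then ?g i else 0)"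
        using assms(1) by (simp add: sum.inter_filter[symmetric])
    qed
    also have "\<dots> = (\<Sum>i\<in>V-{a}. \<Sum>k\<in>V-{a,p a}. if i \<noteq> k \<and> i \<noteq> p k then ?g i else 0)"
      by (rule sum.swap)
    also have "\<dots> = (\<Sum>i\<in>V-{a}. real (card {k \<in> V - {a, p a}. i \<noteq> k \<and> i \<noteq> p k}) * ?g i)"
      using assms(1) by (simp add: sum.inter_filter[symmetric])
    also have "\<dots> = (\<Sum>i\<in>V-{a}. (2 * real n - 4) * ?g i + (if i = p a then 2 * ?g i else 0))"
      using assms(4) by (intro sum.cong refl) (simp only: crd, simp add: of_nat_diff algebra_simps)
    also have "\<dots> = (2 * real n - 4) * (f p * star V a f p) + 2 * ?g (p a)"
      unfolding sum.distrib using assms(1) pa by (simp add: star_def sum_distrib_left)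
    finally show "(\<Sum>k\<in>V-{a,p a}. \<Sum>i\<in>V-{a,k,p k}. ?g i) 
       = (2 * real n - 4) * (f p * star V a f p) + 2 * (f p * f p)"
      using conj_swap_partner[OF p assms(3)] by simp
  qed
  finally show ?thesis by (simp add: ip_def sum.distrib sum_distrib_left)
qed

lemma norm_average:
  assumes "finite V" "card V = 2 * n" "a \<in> V" "n \<ge> 1"
  shows "(\<Sum>k\<in>V-{a}. \<Sum>l\<in>V-{a,k}. ip (V-{k,l}) (f \<circ> add_edge k l) (f \<circ> add_edge k l))
    = (2 * real n - 2) * ip V f f"
proof -
  have "ip (V-{k,l}) (f \<circ> add_edge k l) (f \<circ> add_edge k l) = (\<Sum>p | p \<in> pairings V \<and> p k = l. f p * f p)"
    if "k \<in> V - {a}" "l \<in> V - {a,k}" for k l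
    using that sum_through[of k V l "\<lambda>p. f p * f p"] by (auto simp: ip_def)
  then have "(\<Sum>k\<in>V-{a}. \<Sum>l\<in>V-{a,k}. ip (V-{k,l}) (f \<circ> add_edge k l) (f \<circ> add_edge k l))
     = (\<Sum>k\<in>V-{a}. \<Sum>l\<in>V-{a,k}. \<Sum>p | p \<in> pairings V \<and> p k = l. f p * f p)" by simp
  also have "\<dots> = (\<Sum>p\<in>pairings V. \<Sum>k\<in>V-{a,p a}. f p * f p)"
    by (rule sum_over_edges) (use assms in auto)
  also have "\<dots> = (\<Sum>p\<in>pairings V. (2 * real n - 2) * (f p * f p))"
  proof (rule sum.cong[OF refl])
    fix p assume p: "p \<in> pairings V"
    have "card (V - {a, p a}) = 2 * n - 2"
      using assms pairings_neq[OF p assms(3)] p by (simp add: card_Diff_subset)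
    then show "(\<Sum>k\<in>V-{a,p a}. f p * f p) = (2 * real n - 2) * (f p * f p)"
      using assms(4) by (simp add: of_nat_diff)
  qed
  finally show ?thesis by (simp add: ip_def sum_distrib_left)
qed

text \<open>On four vertices every cell \<open>p a = b\<close> consists of one pairing. The spectral
  inductions below start from this.\<close>

lemma cells_zero_4:
  assumes "finite V" "card V = 4" "a \<in> V" "cells_zero V a f" "p \<in> pairings V"
  shows "f p = 0"
proof -
  have pa: "p a \<in> V" "a \<noteq> p a"
    using assms(3,5) pairings_neq[OF assms(5,3)] by auto
  have "card {q \<in> pairings V. q a = p a} = num_pairings (2 - 1)"
    by (rule card_through) (use assms pa in auto)
  then have "card {q \<in> pairings V. q a = p a} = 1" by simp
  then obtain r where r: "{q \<in> pairings V. q a = p a} = {r}"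
    by (rule card_1_singletonE)
  moreover have "p \<in> {q \<in> pairings V. q a = p a}" using assms(5) by simp
  ultimately have "{q \<in> pairings V. q a = p a} = {p}" by (simp only: singleton_iff)
  moreover have "p a \<in> V - {a}" using pa by auto
  with assms(4) have "(\<Sum>q | q \<in> pairings V \<and> q a = p a. f q) = 0"
    unfolding cells_zero_def by (rule bspec)
  ultimately show ?thesis by (simp only: sum.insert finite.emptyI empty_iff sum.empty) simp
qed

text \<open>Averaging over contracted edges turns the constant \<open>n - 2\<close> into
  \<open>(2 * n * (n - 2) + 2) / (2 * n - 2) = n - 1\<close>, the claim for \<open>Suc n\<close>.
  The bound holds for all functions, so conditioning is harmless here, unlike for the upper bound.
  For \<open>n = 2\<close> the form is a multiple of a square.\<close>

lemma star_lower_bound: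
  assumes "finite V" "card V = 2 * n" "a \<in> V" "n \<ge> 2"
  shows "ip V f (star V a f) \<ge> - (real n - 2) * ip V f f"
  using assms(4,1-3)
proof (induction n arbitrary: V f rule: dec_induct)
  case base
  then have V: "card V = 4" by simp
  have "cell_dev V a f p = 0" if "p \<in> pairings V" for p
    using cells_zero_4[OF base(1) V base(3) cells_zero_dev[OF base] that] .
  then have "ip V (cell_dev V a f) (star V a (cell_dev V a f)) = 0" by (simp add: ip_def)
  then show ?case unfolding cell_split_star[OF base, of f] by simp
next
  case (step n)
  let ?R = "\<lambda>k l. f \<circ> add_edge k l"
  let ?W = "\<lambda>k l. V - {k,l}"
  have "- (real n - 2) * (\<Sum>k\<in>V-{a}. \<Sum>l\<in>V-{a,k}. ip (?W k l) (?R k l) (?R k l))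
    = (\<Sum>k\<in>V-{a}. \<Sum>l\<in>V-{a,k}. - (real n - 2) * ip (?W k l) (?R k l) (?R k l))"
    by (simp only: sum_distrib_left)
  also have "\<dots> \<le> (\<Sum>k\<in>V-{a}. \<Sum>l\<in>V-{a,k}. ip (?W k l) (?R k l) (star (?W k l) a (?R k l)))"
  proof (intro sum_mono step.IH)
    fix k l assume "k \<in> V - {a}" "l \<in> V - {a, k}"
    then show "card (V - {k, l}) = 2 * n" "finite (V - {k, l})" "a \<in> V - {k, l}"
      using step.prems by (auto simp: card_Diff_subset)
  qed
  also have "\<dots> = (2 * real (Suc n) - 4) * ip V f (star V a f) + 2 * ip V f f"
    by (rule star_average) (use step in auto)
  finally have "- (real n - 2) * ((2 * real (Suc n) - 2) * ip V f f) 
      \<le> (2 * real (Suc n) - 4) * ip V f (star V a f) + 2 * ip V f f"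
    using norm_average[OF step.prems, of f] by simp
  then have "(2 * real n - 2) * (- (real (Suc n) - 2) * ip V f f) \<le> (2 * real n - 2) * ip V f (star V a f)"
    by (simp add: algebra_simps)
  moreover have "2 * real n - 2 > 0" using step.hyps by simp
  ultimately show ?case by (meson mult_le_cancel_left_pos)
qed

section \<open>The spectral gap of the star operator\<close>

lemma sum_partner_fun:
  fixes \<phi> :: "'a \<Rightarrow> real"
  assumes "finite V" "card V = 2 * n" "k \<in> V"
  shows "(\<Sum>p\<in>pairings V. \<phi> (p k)) = num_pairings (n - 1) * (\<Sum>l\<in>V-{k}. \<phi> l)"
proof -
  have "(\<Sum>p\<in>pairings V. \<phi> (p k)) = (\<Sum>l\<in>V-{k}. \<Sum>p | p \<in> pairings V \<and> p k = l. \<phi> (p k))"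
    by (rule sum_by_partner[OF assms(1,3)])
  also have "\<dots> = (\<Sum>l\<in>V-{k}. num_pairings (n - 1) * \<phi> l)"
  proof (rule sum.cong[OF refl])
    fix l assume "l \<in> V - {k}"
    then have l: "l \<in> V" "k \<noteq> l" by auto
    have "(\<Sum>p | p \<in> pairings V \<and> p k = l. \<phi> (p k)) = (\<Sum>p | p \<in> pairings V \<and> p k = l. \<phi> l)"
      by (rule sum.cong) auto
    then show "(\<Sum>p | p \<in> pairings V \<and> p k = l. \<phi> (p k)) = num_pairings (n - 1) * \<phi> l"
      using card_through[OF assms l] by simp
  qed
  finally show ?thesis by (simp only: sum_distrib_left)
qed

lemma sum_edge_fun:
  fixes \<phi> :: "'a \<Rightarrow> 'a \<Rightarrow> real"
  assumes "finite V" "card V = 2 * n"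
  shows "(\<Sum>p\<in>pairings V. \<Sum>k\<in>V. \<phi> k (p k)) = num_pairings (n - 1) * (\<Sum>k\<in>V. \<Sum>l\<in>V-{k}. \<phi> k l)"
proof -
  have "(\<Sum>p\<in>pairings V. \<Sum>k\<in>V. \<phi> k (p k)) = (\<Sum>k\<in>V. \<Sum>p\<in>pairings V. \<phi> k (p k))"
    by (rule sum.swap)
  also have "\<dots> = (\<Sum>k\<in>V. num_pairings (n - 1) * (\<Sum>l\<in>V-{k}. \<phi> k l))"
    by (intro sum.cong refl sum_partner_fun assms)
  finally show ?thesis by (simp only: sum_distrib_left)
qed

text \<open>Axiomatises the means \<open>\<phi> k l\<close>, over the pairings through
  \<open>{k, l}\<close>, of a function with zero cell sums at \<open>a\<close>. The rows vanish
  because that function sums to zero over all pairings.\<close>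

locale edge_weights =
  fixes V :: "'a set" and a :: 'a and m :: nat and \<phi> :: "'a \<Rightarrow> 'a \<Rightarrow> real"
  assumes fin: "finite V" and crd: "card V = 2 * m" and m: "m \<ge> 3" and a: "a \<in> V"
    and sym: "\<phi> k l = \<phi> l k" and diag: "\<phi> k k = 0" and at_a: "\<phi> a k = 0"
    and rows: "k \<in> V \<Longrightarrow> (\<Sum>l\<in>V. \<phi> k l) = 0"
begin

text \<open>Shifted so that the target constant is \<open>u + 1\<close>, the inductive one for
  \<open>m - 1\<close> is \<open>u - 1\<close>, and the coefficients in \<open>star_average\<close>
  and \<open>norm_average\<close> are \<open>u\<close> and \<open>u + 2\<close>.\<close>

definition u :: real where "u = 2 * real m - 4"

definition energy :: real where "energy = (\<Sum>k\<in>V. \<Sum>l\<in>V. (\<phi> k l)\<^sup>2)"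

definition total :: "('a \<Rightarrow> 'a) \<Rightarrow> real" where "total p = (\<Sum>k\<in>V. \<phi> k (p k))"

lemma at_a': "\<phi> k a = 0" by (simp only: sym[of k a] at_a)

lemma u_ge: "u \<ge> 2" using m by (simp add: u_def)

lemma num_rec: "real (num_pairings (m - 1)) = (u + 1) * num_pairings (m - 2)"
proof -
  define k where "k = m - 2"
  then have "m - 1 = Suc k" "u = 2 * real k" using m by (auto simp: u_def of_nat_diff)
  then show ?thesis by (simp add: k_def[symmetric] algebra_simps)
qed

lemma rows_minus:
  assumes "k \<in> V" "finite B" "B \<subseteq> V"
  shows "(\<Sum>l\<in>V-B. \<phi> k l) = - (\<Sum>l\<in>B. \<phi> k l)"
  using rows[OF assms(1)] sum_diff[OF fin assms(3), of "\<phi> k"] by simp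

lemma sum_offdiag: "(\<Sum>k\<in>V. \<Sum>l\<in>V-{k}. g (\<phi> k l)) = (\<Sum>k\<in>V. \<Sum>l\<in>V. g (\<phi> k l))"
  if "g 0 = (0::real)" for g
proof (rule sum.cong[OF refl])
  fix k assume "k \<in> V"
  then show "(\<Sum>l\<in>V-{k}. g (\<phi> k l)) = (\<Sum>l\<in>V. g (\<phi> k l))"
    using sum.remove[OF fin, of k "\<lambda>l. g (\<phi> k l)"] diag that by simp
qed

text \<open>The edge \<open>{k, l}\<close>, counted from both ends, contributes
  \<open>2 * \<phi> k l\<close> to each of the \<open>num_pairings (m - 1)\<close> pairings. For the
  other edges the zero rows reduce the sum over pairs avoiding \<open>k\<close> and \<open>l\<close>
  to \<open>2 * \<phi> k l\<close> again, with weight \<open>num_pairings (m - 2)\<close>. So the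
  edge sums of \<open>total\<close> are proportional to \<open>\<phi>\<close>, just as those of the
  function behind \<open>\<phi>\<close>.\<close>

lemma sum_total_through:
  assumes "k \<in> V" "l \<in> V" "k \<noteq> l"
  shows "(\<Sum>p | p \<in> pairings V \<and> p k = l. total p) = 2 * (u + 2) * num_pairings (m - 2) * \<phi> k l"
proof -
  let ?W = "V - {k,l}"
  have W: "finite ?W" "card ?W = 2 * (m - 1)"
    using assms fin crd by (auto simp: card_Diff_subset)
  have crdW: "card (pairings ?W) = num_pairings (m - 1)" by (rule card_pairings[OF W(2,1)])
  have "(\<Sum>p | p \<in> pairings V \<and> p k = l. total p) = (\<Sum>q\<in>pairings ?W. total (add_edge k l q))"
    by (rule sum_through[OF assms])
  also have "\<dots> = (\<Sum>q\<in>pairings ?W. 2 * \<phi> k l + (\<Sum>i\<in>?W. \<phi> i (q i)))"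
  proof (rule sum.cong[OF refl])
    fix q assume q: "q \<in> pairings ?W"
    note ae = add_edge_in[OF q assms]
    have "total (add_edge k l q) = (\<Sum>i\<in>{k,l}. \<phi> i (add_edge k l q i)) + (\<Sum>i\<in>?W. \<phi> i (add_edge k l q i))"
      unfolding total_def using sum.subset_diff[of "{k,l}" V "\<lambda>i. \<phi> i (add_edge k l q i)"] assms fin by simp
    also have "(\<Sum>i\<in>?W. \<phi> i (add_edge k l q i)) = (\<Sum>i\<in>?W. \<phi> i (q i))"
      by (intro sum.cong) (auto simp: ae)
    also have "(\<Sum>i\<in>{k,l}. \<phi> i (add_edge k l q i)) = 2 * \<phi> k l"
      using assms ae(2,3) sym[of l k] by simp
    finally show "total (add_edge k l q) = 2 * \<phi> k l + (\<Sum>i\<in>?W. \<phi> i (q i))" .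
  qed
  also have "\<dots> = num_pairings (m - 1) * (2 * \<phi> k l) + num_pairings (m - 2) * (\<Sum>i\<in>?W. \<Sum>j\<in>?W-{i}. \<phi> i j)"
    unfolding sum.distrib sum_edge_fun[OF W] using crdW by (simp add: numeral_2_eq_2)
  also have "(\<Sum>i\<in>?W. \<Sum>j\<in>?W-{i}. \<phi> i j) = (\<Sum>i\<in>?W. - \<phi> k i - \<phi> l i)"
  proof (rule sum.cong[OF refl])
    fix i assume i: "i \<in> ?W"
    have "?W - {i} = V - {k,l,i}" by auto
    then have *: "(\<Sum>j\<in>?W-{i}. \<phi> i j) = - (\<Sum>j\<in>{k,l,i}. \<phi> i j)"
      using rows_minus[of i "{k,l,i}"] i assms by simp
    then show "(\<Sum>j\<in>?W-{i}. \<phi> i j) = - \<phi> k i - \<phi> l i"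
    proof -
      have "k \<noteq> l" "k \<noteq> i" "l \<noteq> i" using i assms by auto
      then show ?thesis using * diag[of i] sym[of i k] sym[of i l] by simp
    qed
  qed
  also have "\<dots> = 2 * \<phi> k l"
    using rows_minus[of k "{k,l}"] rows_minus[of l "{k,l}"] assms diag sym[of l k]
    by (simp add: sum_subtractf sum_negf)
  finally show ?thesis unfolding num_rec by (simp add: algebra_simps)
qed

lemma sum_mult_total:
  "(\<Sum>p\<in>pairings V. f p * total p)
     = (\<Sum>k\<in>V. \<Sum>l\<in>V-{k}. \<phi> k l * (\<Sum>p | p \<in> pairings V \<and> p k = l. f p))"
proof -
  have "(\<Sum>p\<in>pairings V. f p * total p) = (\<Sum>k\<in>V. \<Sum>p\<in>pairings V. f p * \<phi> k (p k))"
    unfolding total_def sum_distrib_left by (rule sum.swap)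
  also have "\<dots> = (\<Sum>k\<in>V. \<Sum>l\<in>V-{k}. \<phi> k l * (\<Sum>p | p \<in> pairings V \<and> p k = l. f p))"
    by (intro sum.cong refl ip_partner_fun[OF fin, unfolded ip_def, of _ f "\<phi> _"])
  finally show ?thesis .
qed

text \<open>\<open>total\<close> is a combination of edge indicators with coefficients
  \<open>\<phi>\<close>, so an inner product with it sees only the edge sums of
  \<open>f\<close>.\<close>

lemma sum_mult_total_eq:
  assumes "\<And>k l. \<lbrakk>k \<in> V; l \<in> V; k \<noteq> l\<rbrakk> \<Longrightarrow> (\<Sum>p | p \<in> pairings V \<and> p k = l. f p) = c * \<phi> k l"
  shows "(\<Sum>p\<in>pairings V. f p * total p) = c * energy"
proof -
  have "(\<Sum>p\<in>pairings V. f p * total p) = (\<Sum>k\<in>V. \<Sum>l\<in>V-{k}. c * (\<phi> k l)\<^sup>2)"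
    unfolding sum_mult_total
  proof (intro sum.cong refl)
    fix k l assume "k \<in> V" "l \<in> V - {k}"
    then have "k \<in> V" "l \<in> V" "k \<noteq> l" by auto
    from assms[OF this] show "\<phi> k l * (\<Sum>p | p \<in> pairings V \<and> p k = l. f p) = c * (\<phi> k l)\<^sup>2"
      by (simp add: power2_eq_square)
  qed
  also have "\<dots> = c * energy"
    unfolding energy_def sum_distrib_left[symmetric] using sum_offdiag[of "\<lambda>x. x\<^sup>2"] by simp
  finally show ?thesis .
qed

lemma norm_total:
  "(\<Sum>p\<in>pairings V. total p * total p) = 2 * (u + 2) * num_pairings (m - 2) * energy"
  by (rule sum_mult_total_eq) (rule sum_total_through)

text \<open>Up to a scalar, \<open>w b k l\<close> is the mean of \<open>total\<close> over the pairings containing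
  \<open>{a, b}\<close> and \<open>{k, l}\<close>.\<close>

definition w :: "'a \<Rightarrow> 'a \<Rightarrow> 'a \<Rightarrow> real" where
  "w b k l = u * \<phi> k l + \<phi> b k + \<phi> b l"

text \<open>The terms \<open>\<phi> b k\<close> and \<open>\<phi> b l\<close> of \<open>w\<close>
  each run through a full row of \<open>\<phi>\<close>, since \<open>p\<close> permutes
  \<open>V\<close>, and cancel; only \<open>u * \<phi> k l\<close> survives.\<close>

lemma sum_w_pairing:
  assumes p: "p \<in> pairings V"
  shows "(\<Sum>k\<in>V-{a,p a}. w (p a) k (p k)) = u * total p"
proof -
  let ?b = "p a"
  have b: "?b \<in> V" "?b \<noteq> a" "p ?b = a"
    using p a pairings_neq[OF p a] pairings_involutive[OF p] by auto
  have drop: "(\<Sum>k\<in>V-{a,?b}. g k) = (\<Sum>k\<in>V. g k)" if "g a = 0" "g ?b = 0" for g :: "'a \<Rightarrow> real"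
    by (rule sum.mono_neutral_left) (use fin that in auto)
  have bij: "bij_betw p V V" using pairings_permutes[OF p] by (rule permutes_imp_bij)
  have "(\<Sum>k\<in>V-{a,?b}. \<phi> ?b (p k)) = (\<Sum>k\<in>V. \<phi> ?b (p k))"
    by (rule drop) (use b diag at_a' in auto)
  also have "\<dots> = (\<Sum>k\<in>V. \<phi> ?b k)" by (rule sum.reindex_bij_betw[OF bij])
  also have "\<dots> = 0" by (rule rows[OF b(1)])
  finally have 1: "(\<Sum>k\<in>V-{a,?b}. \<phi> ?b (p k)) = 0" .
  have 2: "(\<Sum>k\<in>V-{a,?b}. \<phi> ?b k) = 0"
    using drop[of "\<phi> ?b"] at_a' diag rows[OF b(1)] by simp
  have 3: "(\<Sum>k\<in>V-{a,?b}. \<phi> k (p k)) = total p"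
    unfolding total_def by (rule drop) (use b at_a at_a' in auto)
  show ?thesis
    unfolding w_def sum.distrib sum_distrib_left[symmetric] 1 2 3 by simp
qed

text \<open>After expanding the square, the zero rows reduce every linear sum of
  \<open>\<phi>\<close> to a single entry, leaving the row norms \<open>R\<close> and the Gram
  matrix \<open>C\<close> of the rows, whose own rows sum to zero as well. The factors
  \<open>u - 1\<close> and \<open>u + 2\<close> cancel when a multiple of \<open>w\<close> is used
  as test function in \<open>star_upper_step\<close>.\<close>

lemma sum_w_square:
  "(\<Sum>k\<in>V-{a}. \<Sum>l\<in>V-{a,k}. \<Sum>b\<in>V-{a,k,l}. (w b k l)\<^sup>2) = u * (u - 1) * (u + 2) * energy"
proof -
  define R where "R k = (\<Sum>b\<in>V. (\<phi> k b)\<^sup>2)" for k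
  define C where "C k l = (\<Sum>b\<in>V. \<phi> k b * \<phi> l b)" for k l
  have Ra: "R a = 0" by (simp add: R_def at_a)
  have Ca: "C k a = 0" "C a k = 0" for k by (simp_all add: C_def at_a)
  have C_diag: "C k k = R k" for k by (simp add: C_def R_def power2_eq_square)
  have R_sum: "(\<Sum>k\<in>V-{a}. R k) = energy"
    using sum.remove[OF fin a, of R] Ra by (simp add: energy_def R_def)
  have C_sum: "(\<Sum>l\<in>V. C k l) = 0" for k
  proof -
    have "(\<Sum>l\<in>V. C k l) = (\<Sum>b\<in>V. \<phi> k b * (\<Sum>l\<in>V. \<phi> b l))"
      unfolding C_def sum_distrib_left using sym by (subst sum.swap) simp
    also have "\<dots> = 0" using rows by simp
    finally show ?thesis .
  qed
  have inner: "(\<Sum>b\<in>V-{a,k,l}. (w b k l)\<^sup>2) =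
      (u\<^sup>2 * (u + 1) - 4 * u - 2) * (\<phi> k l)\<^sup>2 + R k + R l + 2 * C k l"
    if k: "k \<in> V - {a}" and l: "l \<in> V - {a, k}" for k l
  proof -
    let ?B = "V - {a,k,l}"
    have ne: "a \<noteq> k" "a \<noteq> l" "k \<noteq> l" using k l by auto
    then have crdB: "real (card ?B) = u + 1"
      using k l a fin crd m by (simp add: card_Diff_subset u_def of_nat_diff)
    have R1: "(\<Sum>b\<in>?B. (\<phi> k b)\<^sup>2) = R k - (\<phi> k l)\<^sup>2" 
      using sum_diff[OF fin, of "{a,k,l}" "\<lambda>b. (\<phi> k b)\<^sup>2"] k l a ne by (simp add: R_def diag at_a')
    have R2: "(\<Sum>b\<in>?B. (\<phi> l b)\<^sup>2) = R l - (\<phi> k l)\<^sup>2" 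
      using sum_diff[OF fin, of "{a,k,l}" "\<lambda>b. (\<phi> l b)\<^sup>2"] k l a ne sym[of l k] by (simp add: R_def diag at_a')
    have CC: "(\<Sum>b\<in>?B. \<phi> k b * \<phi> l b) = C k l" 
      using sum_diff[OF fin, of "{a,k,l}" "\<lambda>b. \<phi> k b * \<phi> l b"] k l a ne by (simp add: C_def diag at_a')
    have r1: "(\<Sum>b\<in>?B. \<phi> k b) = - \<phi> k l"
      using rows_minus[of k "{a,k,l}"] k l a ne by (simp add: diag at_a')
    have r2: "(\<Sum>b\<in>?B. \<phi> l b) = - \<phi> k l"
      using rows_minus[of l "{a,k,l}"] k l a ne sym[of l k] by (simp add: diag at_a')
    have "(\<Sum>b\<in>?B. (w b k l)\<^sup>2) = (\<Sum>b\<in>?B. u\<^sup>2 * (\<phi> k l)\<^sup>2 + (\<phi> k b)\<^sup>2 + (\<phi> l b)\<^sup>2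
       + 2 * (\<phi> k b * \<phi> l b) + 2 * u * \<phi> k l * \<phi> k b + 2 * u * \<phi> k l * \<phi> l b)"
    proof (rule sum.cong[OF refl])
      fix b
      show "(w b k l)\<^sup>2 = u\<^sup>2 * (\<phi> k l)\<^sup>2 + (\<phi> k b)\<^sup>2 + (\<phi> l b)\<^sup>2
       + 2 * (\<phi> k b * \<phi> l b) + 2 * u * \<phi> k l * \<phi> k b + 2 * u * \<phi> k l * \<phi> l b"
        unfolding w_def sym[of b k] sym[of b l] by (simp add: power2_eq_square algebra_simps)
    qed
    also have "\<dots> = (u + 1) * (u\<^sup>2 * (\<phi> k l)\<^sup>2) + (R k - (\<phi> k l)\<^sup>2) + (R l - (\<phi> k l)\<^sup>2) + 2 * C k l
       + 2 * u * \<phi> k l * (- \<phi> k l) + 2 * u * \<phi> k l * (- \<phi> k l)"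
      unfolding sum.distrib sum_distrib_left[symmetric] R1 R2 CC r1 r2 sum_constant crdB
      by (simp add: algebra_simps)
    also have "\<dots> = (u\<^sup>2 * (u + 1) - 4 * u - 2) * (\<phi> k l)\<^sup>2 + R k + R l + 2 * C k l"
      by (simp add: power2_eq_square algebra_simps)
    finally show ?thesis .
  qed
  have "(\<Sum>l\<in>V-{a,k}. \<Sum>b\<in>V-{a,k,l}. (w b k l)\<^sup>2)
     = (u\<^sup>2 * (u + 1) - 4 * u - 2) * R k + (u + 2) * R k + (energy - R k) - 2 * R k"
    if k: "k \<in> V - {a}" for k
  proof -
    have ne: "a \<noteq> k" using k by auto
    then have crdA: "real (card (V - {a,k})) = u + 2"
      using k a fin crd m by (simp add: card_Diff_subset u_def of_nat_diff)
    have s1: "(\<Sum>l\<in>V-{a,k}. (\<phi> k l)\<^sup>2) = R k"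
      using sum_diff[OF fin, of "{a,k}" "\<lambda>l. (\<phi> k l)\<^sup>2"] k a ne by (simp add: R_def diag at_a')
    have "V - {a,k} = V - {a} - {k}" by auto
    then have s2: "(\<Sum>l\<in>V-{a,k}. R l) = energy - R k"
      using R_sum k fin by (simp add: sum_diff1)
    have s3: "(\<Sum>l\<in>V-{a,k}. C k l) = - R k"
      using sum_diff[OF fin, of "{a,k}" "C k"] k a ne C_sum[of k] by (simp add: Ca C_diag)
    have "(\<Sum>l\<in>V-{a,k}. \<Sum>b\<in>V-{a,k,l}. (w b k l)\<^sup>2) =
      (\<Sum>l\<in>V-{a,k}. (u\<^sup>2 * (u + 1) - 4 * u - 2) * (\<phi> k l)\<^sup>2 + R k + R l + 2 * C k l)"
      by (intro sum.cong refl inner k)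
    also have "\<dots> = (u\<^sup>2 * (u + 1) - 4 * u - 2) * R k + (u + 2) * R k + (energy - R k) + 2 * (- R k)"
      unfolding sum.distrib sum_distrib_left[symmetric] s1 s2 s3 sum_constant crdA
      by (simp add: algebra_simps)
    finally show ?thesis by simp
  qed
  then have "(\<Sum>k\<in>V-{a}. \<Sum>l\<in>V-{a,k}. \<Sum>b\<in>V-{a,k,l}. (w b k l)\<^sup>2)
     = (\<Sum>k\<in>V-{a}. (u\<^sup>2 * (u + 1) - 4 * u - 2) * R k + (u + 2) * R k + (energy - R k) - 2 * R k)"
    by (intro sum.cong refl)
  also have "\<dots> = (\<Sum>k\<in>V-{a}. (u\<^sup>2 * (u + 1) - 3 * u - 3) * R k + energy)"
    by (intro sum.cong refl) (simp add: algebra_simps)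
  also have "\<dots> = (u\<^sup>2 * (u + 1) - 3 * u - 3) * energy + (u + 3) * energy"
    unfolding sum.distrib sum_distrib_left[symmetric] R_sum
    using a fin crd m by (simp add: u_def of_nat_diff)
  also have "\<dots> = u * (u - 1) * (u + 2) * energy"
    by (simp add: power2_eq_square algebra_simps)
  finally show ?thesis .
qed

end


text \<open>The squared norm of a projection of \<open>g\<close> is at least
  \<open>2 <g, h> - <h, h>\<close> for each \<open>h\<close> in its range. A well-chosen test
  function thus bounds the averages from below without computing them.\<close>

lemma cell_avg_lower:
  assumes "finite V" "card V = 2 * n" "a \<in> V"
  shows "ip V (cell_avg V a g) (cell_avg V a g) \<ge> (\<Sum>q\<in>pairings V. 2 * (g q * h (q a)) - (h (q a))\<^sup>2)"
proof -
  let ?A = "cell_avg V a g"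
  have "(\<Sum>q\<in>pairings V. (g q - ?A q) * h (q a)) = 0"
    using ip_cells_zero[OF assms(1,3) cells_zero_dev[OF assms], of g h] by (simp add: ip_def cell_dev_def)
  then have "(\<Sum>q\<in>pairings V. g q * h (q a)) = (\<Sum>q\<in>pairings V. ?A q * h (q a))"
    by (simp add: left_diff_distrib sum_subtractf)
  then have "(\<Sum>q\<in>pairings V. 2 * (g q * h (q a)) - (h (q a))\<^sup>2) = (\<Sum>q\<in>pairings V. 2 * (?A q * h (q a)) - (h (q a))\<^sup>2)"
    by (simp only: sum_subtractf sum_distrib_left[symmetric])
  also have "\<dots> \<le> (\<Sum>q\<in>pairings V. ?A q * ?A q)"
  proof (rule sum_mono)
    fix q
    have "0 \<le> (?A q - h (q a))\<^sup>2" by simp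
    then show "2 * (?A q * h (q a)) - (h (q a))\<^sup>2 \<le> ?A q * ?A q"
      by (simp add: power2_eq_square algebra_simps)
  qed
  finally show ?thesis by (simp only: ip_def)
qed

text \<open>Conditioning on an edge \<open>{k, l}\<close> and using the bound for \<open>m - 1\<close> loses the conditional
  averages \<open>P\<close>; testing against multiples of \<open>total\<close> and \<open>w\<close>, which span the extremal
  direction, recovers exactly the loss.\<close>

lemma star_upper_step:
  assumes fin: "finite V" and crd: "card V = 2 * m" and a: "a \<in> V" and m: "m \<ge> 3"
    and cz: "cells_zero V a f"
    and IH: "\<And>W g. \<lbrakk>finite W; card W = 2 * (m - 1); a \<in> W; cells_zero W a g\<rbrakk>
      \<Longrightarrow> ip W g (star W a g) \<le> (2 * real (m - 1) - 3) * ip W g g"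
  shows "ip V f (star V a f) \<le> (2 * real m - 3) * ip V f f"
proof -
  \<comment> \<open>The value 0 on the diagonal lets rows be summed over all of
    \<open>V\<close>.\<close>
  define \<phi> where "\<phi> k l = (if k \<in> V \<and> l \<in> V \<and> k \<noteq> l then edge_mean V f k l else 0)" for k l
  have through: "(\<Sum>p | p \<in> pairings V \<and> p k = l. f p) = num_pairings (m - 1) * \<phi> k l"
    if "k \<in> V" "l \<in> V" "k \<noteq> l" for k l
    using edge_mean_sum[OF fin crd that] that by (simp add: \<phi>_def)
  have at_a: "\<phi> a k = 0" for k
  proof (cases "k \<in> V - {a}")
    case True
    then have "(\<Sum>p | p \<in> pairings V \<and> p a = k. f p) = 0" using cz unfolding cells_zero_def by (rule bspec[rotated])
    then show ?thesis by (simp add: \<phi>_def edge_mean_def)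
  qed (auto simp: \<phi>_def)
  interpret edge_weights V a m \<phi>
  proof
    show "\<phi> k l = \<phi> l k" for k l by (simp add: \<phi>_def edge_mean_commute[of V f k l] eq_commute[of k l])
    show "\<phi> k k = 0" for k by (simp add: \<phi>_def)
    show "(\<Sum>l\<in>V. \<phi> k l) = 0" if k: "k \<in> V" for k
    proof -
      have "(\<Sum>l\<in>V. \<phi> k l) = (\<Sum>l\<in>V-{k}. edge_mean V f k l)"
        by (rule sum.mono_neutral_cong_right) (use fin k in \<open>auto simp: \<phi>_def\<close>)
      moreover have "num_pairings (m - 1) * (\<Sum>l\<in>V-{k}. edge_mean V f k l) = 0"
        using sum_edge_means[OF fin crd k, of f] cells_zero_sum[OF fin a cz] by simp
      ultimately show ?thesis using num_pairings_pos[of "m-1"] by simp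
    qed
  qed (use assms at_a in auto)
  define F where "F = ip V f f"
  define N where "N = real (num_pairings (m - 2))"
  \<comment> \<open>\<open>t / 2 * total\<close> is the orthogonal projection of \<open>f\<close>
    onto \<open>total\<close>: the inner product is \<open>(u + 1) * N * energy\<close> and the
    squared norm of \<open>total\<close> is \<open>2 * (u + 2) * N * energy\<close>. The factor
    \<open>c\<close> maximises the lower bound for \<open>P\<close>, which is quadratic in
    \<open>c\<close>. Expressed through \<open>u\<close> alone, both avoid dividing by
    \<open>energy\<close>, which may be 0.\<close>
  define t where "t = (u + 1) / (u + 2)"
  define c where "c = t / (u - 1)"
  define q where "q = (\<Sum>p\<in>pairings V. f p * total p)"
  have t: "t * (u + 2) = u + 1" and c: "c * (u - 1) = t" using u_ge by (simp_all add: t_def c_def)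
  have N: "N > 0" "real (num_pairings (m - 1)) = (u + 1) * N"
    using num_pairings_pos num_rec by (simp_all add: N_def)
  have q: "q = (u + 1) * N * energy"
    unfolding q_def N(2)[symmetric] by (rule sum_mult_total_eq) (rule through)
  have tt: "t * (2 * (u + 2) * N * energy) = 2 * q"
    unfolding q t[symmetric] by (simp add: algebra_simps)
  \<comment> \<open>Bessel's inequality for \<open>f\<close> and \<open>total\<close>, scaled by
    4.\<close>
  have norm_f: "4 * F \<ge> 2 * t * q"
  proof -
    have "0 \<le> (\<Sum>p\<in>pairings V. (2 * f p - t * total p)\<^sup>2)" by (intro sum_nonneg) simp
    also have "\<dots> = (\<Sum>p\<in>pairings V. 4 * (f p * f p) - 4 * t * (f p * total p) + t\<^sup>2 * (total p * total p))"
      by (intro sum.cong refl) (simp add: power2_eq_square algebra_simps)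
    also have "\<dots> = 4 * F - 4 * t * q + t\<^sup>2 * (2 * (u + 2) * N * energy)"
      unfolding sum.distrib sum_subtractf sum_distrib_left[symmetric] norm_total
      by (simp add: F_def ip_def q_def N_def)
    also have "t\<^sup>2 * (2 * (u + 2) * N * energy) = t * (2 * q)"
      unfolding tt[symmetric] by (simp add: power2_eq_square)
    finally show ?thesis by simp
  qed
  let ?W = "\<lambda>k l. V - {k,l}"
  let ?g = "\<lambda>k l. f \<circ> add_edge k l"
  let ?A = "\<lambda>k l. cell_avg (?W k l) a (?g k l)"
  have W: "finite (?W k l)" "card (?W k l) = 2 * (m - 1)" "a \<in> ?W k l" 
      "k \<in> V" "l \<in> V" "k \<noteq> l"
    if "k \<in> V - {a}" "l \<in> V - {a,k}" for k l
    using that fin crd a by (auto simp: card_Diff_subset)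
  define P where "P = (\<Sum>k\<in>V-{a}. \<Sum>l\<in>V-{a,k}. ip (?W k l) (?A k l) (?A k l))"
  have P: "(u - 1) * P \<ge> t * u * q"
  proof -
    have le: "(\<Sum>p | p \<in> pairings V \<and> p k = l. 2 * c * (f p * w (p a) k l)) - N * c\<^sup>2 * (\<Sum>b\<in>V-{a,k,l}. (w b k l)\<^sup>2)
        \<le> ip (?W k l) (?A k l) (?A k l)"
      if kl: "k \<in> V - {a}" "l \<in> V - {a,k}" for k l
    proof -
      note W = W[OF kl]
      have 1: "(\<Sum>p | p \<in> pairings V \<and> p k = l. 2 * c * (f p * w (p a) k l))
         = (\<Sum>q\<in>pairings (?W k l). 2 * (?g k l q * (c * w (q a) k l)))"
        unfolding sum_through[OF W(4-6)]
        by (rule sum.cong[OF refl]) (use add_edge_in(4)[OF _ W(4-6), of _ a] kl in auto)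
      have "(\<Sum>q\<in>pairings (?W k l). (c * w (q a) k l)\<^sup>2) = num_pairings (m - 1 - 1) * (\<Sum>b\<in>?W k l - {a}. (c * w b k l)\<^sup>2)"
        by (rule sum_partner_fun[OF W(1-3)])
      also have "?W k l - {a} = V - {a,k,l}" by auto
      also have "m - 1 - 1 = m - 2" by simp
      finally have 2: "(\<Sum>q\<in>pairings (?W k l). (c * w (q a) k l)\<^sup>2) = N * c\<^sup>2 * (\<Sum>b\<in>V-{a,k,l}. (w b k l)\<^sup>2)"
        by (simp add: power_mult_distrib sum_distrib_left[symmetric] N_def mult.assoc)
      show ?thesis
        using cell_avg_lower[OF W(1-3), of "?g k l" "\<lambda>b. c * w b k l"] 
        unfolding sum_subtractf 1 2 .
    qed
    have "(\<Sum>k\<in>V-{a}. \<Sum>l\<in>V-{a,k}. \<Sum>p | p \<in> pairings V \<and> p k = l. 2 * c * (f p * w (p a) k l))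
       = (\<Sum>p\<in>pairings V. \<Sum>k\<in>V-{a,p a}. 2 * c * (f p * w (p a) k (p k)))"
      by (rule sum_over_edges[OF fin a])
    also have "\<dots> = (\<Sum>p\<in>pairings V. 2 * c * u * (f p * total p))"
      by (rule sum.cong[OF refl]) (simp add: sum_distrib_left[symmetric] sum_w_pairing)
    also have "\<dots> = 2 * c * u * q"
      by (simp only: sum_distrib_left q_def)
    finally have 1: "(\<Sum>k\<in>V-{a}. \<Sum>l\<in>V-{a,k}. \<Sum>p | p \<in> pairings V \<and> p k = l. 2 * c * (f p * w (p a) k l))
       = 2 * c * u * q" .
    have "2 * c * u * q - N * c\<^sup>2 * (u * (u - 1) * (u + 2) * energy)
      = (\<Sum>k\<in>V-{a}. \<Sum>l\<in>V-{a,k}. (\<Sum>p | p \<in> pairings V \<and> p k = l. 2 * c * (f p * w (p a) k l))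
           - N * c\<^sup>2 * (\<Sum>b\<in>V-{a,k,l}. (w b k l)\<^sup>2))"
      unfolding 1[symmetric] sum_w_square[symmetric] by (simp only: sum_subtractf sum_distrib_left)
    also have "\<dots> \<le> P"
      unfolding P_def by (intro sum_mono le)
    finally have "(u - 1) * (2 * c * u * q - N * c\<^sup>2 * (u * (u - 1) * (u + 2) * energy)) \<le> (u - 1) * P"
      using u_ge by (simp add: mult_left_mono)
    also have "(u - 1) * (2 * c * u * q - N * c\<^sup>2 * (u * (u - 1) * (u + 2) * energy))
      = 2 * (c * (u - 1)) * u * q - (c * (u - 1))\<^sup>2 * u * ((u + 2) * N * energy)"
      by (simp add: power2_eq_square algebra_simps)
    also have "\<dots> = 2 * t * u * q - t * u * (t * ((u + 2) * N * energy))"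
      unfolding c by (simp add: power2_eq_square algebra_simps)
    also have "t * ((u + 2) * N * energy) = q" using tt by (simp add: algebra_simps)
    finally show ?thesis by (simp add: mult.commute mult.left_commute)
  qed
  \<comment> \<open>The conditioned function need not have zero cell sums, so the inductive bound is
    applied to its deviation; its averages enter \<open>star\<close> only through the squared sum
    \<open>((u + 1) * N * \<phi> k l)\<^sup>2 / N\<close>.\<close>
  have each: "ip (?W k l) (?g k l) (star (?W k l) a (?g k l))
      \<le> (u - 1) * (ip (?W k l) (?g k l) (?g k l) - ip (?W k l) (?A k l) (?A k l)) + (u + 1)\<^sup>2 * N * (\<phi> k l)\<^sup>2"
    if kl: "k \<in> V - {a}" "l \<in> V - {a,k}" for k l
  proof -
    note W = W[OF kl]
    let ?D = "cell_dev (?W k l) a (?g k l)"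
    have "(\<Sum>q\<in>pairings (?W k l). ?g k l q) = (u + 1) * N * \<phi> k l"
      using sum_through[OF W(4-6), of f] through[OF W(4-6)] N(2) by (simp add: comp_def)
    then have sq: "(\<Sum>q\<in>pairings (?W k l). ?g k l q)\<^sup>2 / num_pairings (m - 1 - 1) = (u + 1)\<^sup>2 * N * (\<phi> k l)\<^sup>2"
      using N(1) by (simp add: N_def numeral_2_eq_2 power_mult_distrib power2_eq_square)
    have "ip (?W k l) ?D (star (?W k l) a ?D) \<le> (2 * real (m - 1) - 3) * ip (?W k l) ?D ?D"
      by (rule IH[OF W(1-3) cells_zero_dev[OF W(1-3)]])
    also have "2 * real (m - 1) - 3 = u - 1" using m by (simp add: u_def of_nat_diff)
    also have "ip (?W k l) ?D ?D = ip (?W k l) (?g k l) (?g k l) - ip (?W k l) (?A k l) (?A k l)"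
      using cell_split_norm[OF W(1-3), of "?g k l"] by simp
    finally show ?thesis
      using cell_split_star[OF W(1-3), of "?g k l"] unfolding sq by linarith
  qed
  have phi_sum: "(\<Sum>k\<in>V-{a}. \<Sum>l\<in>V-{a,k}. (\<phi> k l)\<^sup>2) = energy"
  proof -
    have "(\<Sum>l\<in>V-{a,k}. (\<phi> k l)\<^sup>2) = (\<Sum>l\<in>V. (\<phi> k l)\<^sup>2)" for k
      by (rule sum.mono_neutral_left) (use fin diag at_a' in auto)
    moreover have "(\<Sum>k\<in>V-{a}. \<Sum>l\<in>V. (\<phi> k l)\<^sup>2) = energy"
      unfolding energy_def by (rule sum.mono_neutral_left) (use fin at_a in auto)
    ultimately show ?thesis by simp
  qed
  have "u * ip V f (star V a f) + 2 * F = (\<Sum>k\<in>V-{a}. \<Sum>l\<in>V-{a,k}. ip (?W k l) (?g k l) (star (?W k l) a (?g k l)))"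
    using star_average[OF fin crd a, of f] m by (simp add: F_def u_def)
  also have "\<dots> \<le> (\<Sum>k\<in>V-{a}. \<Sum>l\<in>V-{a,k}. (u - 1) * (ip (?W k l) (?g k l) (?g k l) - ip (?W k l) (?A k l) (?A k l)) 
       + (u + 1)\<^sup>2 * N * (\<phi> k l)\<^sup>2)"
    by (intro sum_mono each)
  also have "\<dots> = (u - 1) * ((\<Sum>k\<in>V-{a}. \<Sum>l\<in>V-{a,k}. ip (?W k l) (?g k l) (?g k l)) - P) + (u + 1)\<^sup>2 * N * energy"
    unfolding P_def phi_sum[symmetric] by (simp only: sum_subtractf sum_distrib_left[symmetric] sum.distrib)
  also have "(\<Sum>k\<in>V-{a}. \<Sum>l\<in>V-{a,k}. ip (?W k l) (?g k l) (?g k l)) = (u + 2) * F"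
    using norm_average[OF fin crd a, of f] m by (simp add: F_def u_def)
  also have "(u + 1)\<^sup>2 * N * energy = t * (u + 2) * q"
    unfolding q t by (simp add: power2_eq_square)
  finally have "u * ip V f (star V a f) \<le> (u - 1) * ((u + 2) * F) - (u - 1) * P + t * (u + 2) * q - 2 * F"
    by (simp add: algebra_simps)
  \<comment> \<open>The terms in \<open>q\<close> balance:
    \<open>t * (u + 2) - t * u = 2 * t\<close>, which \<open>norm_f\<close> trades for
    \<open>4 * F\<close>; then \<open>(u - 1) * (u + 2) + 2 = u * (u + 1)\<close> produces the
    target constant.\<close>
  also have "\<dots> \<le> (u - 1) * ((u + 2) * F) + 2 * t * q - 2 * F"
    using P by (simp add: algebra_simps)
  also have "\<dots> \<le> (u - 1) * ((u + 2) * F) + 4 * F - 2 * F"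
    using norm_f by simp
  also have "\<dots> = u * ((u + 1) * F)" by (simp add: algebra_simps)
  finally have "ip V f (star V a f) \<le> (u + 1) * F" using u_ge by simp
  then show ?thesis by (simp add: F_def u_def)
qed

lemma star_upper_bound:
  assumes "n \<ge> 2" "finite V" "card V = 2 * n" "a \<in> V" "cells_zero V a f"
  shows "ip V f (star V a f) \<le> (2 * real n - 3) * ip V f f"
  using assms
proof (induction n arbitrary: V f rule: dec_induct)
  case base
  then have V: "card V = 4" by simp
  have "f p = 0" if "p \<in> pairings V" for p
    by (rule cells_zero_4[OF base(1) V base(3,4) that])
  then show ?case by (simp add: ip_def)
next
  case (step n)
  show ?case
    by (rule star_upper_step) (use step in auto)
qed

section \<open>Hamiltonian pairs\<close>

text \<open>The union of two pairings is a Hamiltonian cycle (or a double edge) iff no proper nonempty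
  vertex set is closed under both.\<close>

definition ham :: "'a set \<Rightarrow> ('a \<Rightarrow> 'a) \<Rightarrow> ('a \<Rightarrow> 'a) \<Rightarrow> bool" where
  "ham V p q \<longleftrightarrow> (\<forall>S. S \<subseteq> V \<and> S \<noteq> {} \<and> p ` S \<subseteq> S \<and> q ` S \<subseteq> S \<longrightarrow> S = V)"

lemma ham_commute: "ham V p q \<longleftrightarrow> ham V q p"
  unfolding ham_def by (metis (no_types))

lemma hamD: "ham V p q \<Longrightarrow> S \<subseteq> V \<Longrightarrow> S \<noteq> {} \<Longrightarrow> p ` S \<subseteq> S \<Longrightarrow> q ` S \<subseteq> S \<Longrightarrow> S = V"
  unfolding ham_def by blast

lemma not_ham_common_edge:
  assumes "p \<in> pairings V" "q \<in> pairings V" "a \<in> V" "p a = q a" "V \<noteq> {a, p a}"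
  shows "\<not> ham V p q"
proof
  assume h: "ham V p q"
  have pp: "p (p a) = a" "q (p a) = a"
    using assms pairings_involutive[of p V a] pairings_involutive[of q V a] by auto
  have "{a, p a} = V" by (rule hamD[OF h]) (use pp assms in auto)
  then show False using assms by simp
qed

text \<open>With \<open>j = y i\<close>, the switched pairing has the edges \<open>{a, j}\<close>
  and \<open>{b, i}\<close> in place of \<open>{a, b}\<close> and \<open>{i, j}\<close>. In the
  union, the edge \<open>{i, j}\<close> of \<open>y\<close> is thus replaced by the path
  \<open>i, b, a, j\<close> through the edge \<open>{a, b}\<close> of the other pairing, and
  subdividing an edge of a cycle does not affect whether the cycle is Hamiltonian.\<close>

lemma ham_contract:
  assumes ab: "a \<in> V" "b \<in> V" "a \<noteq> b"
    and x: "x \<in> pairings (V - {a,b})" and y: "y \<in> pairings (V - {a,b})" and i: "i \<in> V - {a,b}"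
  shows "ham V (add_edge a b x) (conj_swap a i (add_edge a b y)) \<longleftrightarrow> ham (V - {a,b}) x y"
proof -
  let ?W = "V - {a,b}"
  define j where "j = y i"
  define X where "X = add_edge a b x"
  define Y where "Y = conj_swap a i (add_edge a b y)"
  have j: "j \<in> ?W" "j \<noteq> i" "y j = i" "y i = j"
    using i pairings_in[OF y, of i] pairings_neq[OF y i] pairings_involutive[OF y] unfolding j_def by blast+
  have X: "X a = b" "X b = a" "\<And>v. v \<noteq> a \<Longrightarrow> v \<noteq> b \<Longrightarrow> X v = x v"
    using add_edge_in[OF x ab] by (auto simp: X_def)
  note ye = add_edge_in[OF y ab]
  have Yv: "Y v = (if v = a then j else if v = i then b else if v = b then i else if v = j then a else add_edge a b y v)" for v
    unfolding Y_def using conj_swap_apply[OF ye(1) ab(1), of i v] i ye(2) ye(4)[of i] j by auto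
  have Y: "Y a = j" "Y i = b" "Y b = i" "Y j = a" 
    "\<And>v. v \<in> ?W \<Longrightarrow> v \<noteq> i \<Longrightarrow> v \<noteq> j \<Longrightarrow> Y v = y v"
    using i j ab ye(4) by (auto simp: Yv)
  show ?thesis
    unfolding X_def[symmetric] Y_def[symmetric]
  proof
    assume h: "ham V X Y"
    show "ham ?W x y" unfolding ham_def
    proof (intro allI impI)
      fix S assume S: "S \<subseteq> ?W \<and> S \<noteq> {} \<and> x ` S \<subseteq> S \<and> y ` S \<subseteq> S"
      \<comment> \<open>The new vertices are added exactly when the closed set contains the
        subdivided edge.\<close>
      define S' where "S' = S \<union> (if i \<in> S then {a,b} else {})"
      have ij: "i \<in> S \<longleftrightarrow> j \<in> S" using S j by (metis image_subset_iff)
      have "X v \<in> S'" if "v \<in> S'" for v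
        using that S X by (cases "v \<in> S") (auto simp: S'_def split: if_splits)
      then have XS: "X ` S' \<subseteq> S'" by (rule image_subsetI)
      have "Y v \<in> S'" if "v \<in> S'" for v
      proof (cases "v \<in> S")
        case True
        then have "v \<in> ?W" "y v \<in> S" using S by auto
        then show ?thesis using True Y(2,4) Y(5)[of v] ij by (cases "v = i \<or> v = j") (auto simp: S'_def)
      next
        case False
        then have "i \<in> S" "v = a \<or> v = b" using that by (auto simp: S'_def split: if_splits)
        then show ?thesis using Y(1,3) ij by (auto simp: S'_def)
      qed
      then have YS: "Y ` S' \<subseteq> S'" by (rule image_subsetI)
      have "S' = V"
        by (rule hamD[OF h _ _ XS YS]) (use S ab in \<open>auto simp: S'_def\<close>)
      then show "S = ?W" using S by (auto simp: S'_def split: if_splits)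
    qed
  next
    assume h: "ham ?W x y"
    show "ham V X Y" unfolding ham_def
    proof (intro allI impI)
      fix S assume S: "S \<subseteq> V \<and> S \<noteq> {} \<and> X ` S \<subseteq> S \<and> Y ` S \<subseteq> S"
      then have cl: "\<And>v. v \<in> S \<Longrightarrow> X v \<in> S" "\<And>v. v \<in> S \<Longrightarrow> Y v \<in> S" by auto
      have imp: "i \<in> S \<longleftrightarrow> a \<in> S" "j \<in> S \<longleftrightarrow> a \<in> S" "b \<in> S \<longleftrightarrow> a \<in> S"
        using cl(1)[of b] cl(1)[of a] cl(2)[of i] cl(2)[of a] cl(2)[of j] cl(2)[of b]
        unfolding X(1,2) Y(1-4) by blast+
      have "x v \<in> S \<inter> ?W" if "v \<in> S \<inter> ?W" for v
        using that cl(1)[of v] X(3)[of v] pairings_in[OF x, of v] by auto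
      then have xS: "x ` (S \<inter> ?W) \<subseteq> S \<inter> ?W" by (rule image_subsetI)
      have "y v \<in> S \<inter> ?W" if "v \<in> S \<inter> ?W" for v
      proof -
        have "y i \<in> S" if "i \<in> S" using that imp j by simp
        moreover have "y j \<in> S" if "j \<in> S" using that imp j by simp
        moreover have "y v \<in> S" if "v \<noteq> i" "v \<noteq> j"
          using that \<open>v \<in> S \<inter> ?W\<close> cl(2)[of v] Y(5)[of v] by simp
        ultimately have "y v \<in> S" using that by blast
        then show ?thesis using that pairings_in[OF y, of v] by auto
      qed
      then have yS: "y ` (S \<inter> ?W) \<subseteq> S \<inter> ?W" by (rule image_subsetI)
      have "S \<inter> ?W \<noteq> {}"
        using S imp i j by (cases "S \<inter> {a,b} = {}") auto
      then have "S \<inter> ?W = ?W"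
        by (intro hamD[OF h _ _ xS yS]) auto
      then show "S = V" using S imp i j by auto
    qed
  qed
qed

section \<open>The operator of the Hamiltonian relation and its contraction\<close>

definition ham_op :: "'a set \<Rightarrow> (('a \<Rightarrow> 'a) \<Rightarrow> real) \<Rightarrow> ('a \<Rightarrow> 'a) \<Rightarrow> real" where
  "ham_op V f p = (\<Sum>q\<in>pairings V. if ham V p q then f q else 0)"

lemma ham_op_cong:
  "(\<And>p. p \<in> pairings V \<Longrightarrow> f p = g p) \<Longrightarrow> ham_op V f p = ham_op V g p"
  unfolding ham_op_def by (rule sum.cong) auto

lemma ham_op_diff: "ham_op V (\<lambda>p. f p - g p) p = ham_op V f p - ham_op V g p"
  unfolding ham_op_def sum_subtractf[symmetric] by (rule sum.cong) auto

lemma ham_op_selfadj: "ip V f (ham_op V g) = ip V (ham_op V f) g"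
proof -
  have "ip V f (ham_op V g) = (\<Sum>p\<in>pairings V. \<Sum>q\<in>pairings V. if ham V p q then f p * g q else 0)"
    unfolding ip_def ham_op_def sum_distrib_left by (intro sum.cong refl) auto
  also have "\<dots> = (\<Sum>q\<in>pairings V. \<Sum>p\<in>pairings V. if ham V p q then f p * g q else 0)"
    by (rule sum.swap)
  also have "\<dots> = ip V (ham_op V f) g"
    unfolding ip_def ham_op_def sum_distrib_right
    by (intro sum.cong refl) (auto simp: ham_commute)
  finally show ?thesis .
qed

text \<open>A pairing \<open>y\<close> without the edge \<open>{a, b}\<close> arises from a unique
  index: \<open>i\<close> must be the partner of \<open>b\<close> in \<open>y\<close>, and switching
  \<open>a\<close> with it creates the edge \<open>{a, b}\<close>, which is then removed.\<close>

lemma sum_by_contraction: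
  fixes g :: "('a \<Rightarrow> 'a) \<Rightarrow> real"
  assumes "finite V" and ab: "a \<in> V" "b \<in> V" "a \<noteq> b"
  shows "(\<Sum>y | y \<in> pairings V \<and> y a \<noteq> b. g y)
    = (\<Sum>q\<in>pairings (V-{a,b}). \<Sum>i\<in>V-{a,b}. g (conj_swap a i (add_edge a b q)))"
proof -
  let ?W = "V - {a,b}"
  let ?F = "\<lambda>(q, i). conj_swap a i (add_edge a b q)"
  let ?G = "\<lambda>y. (add_edge a b (conj_swap a (y b) y), y b)"
  have F: "?F (q,i) \<in> {y \<in> pairings V. y a \<noteq> b}" "?G (?F (q,i)) = (q,i)"
    if q: "q \<in> pairings ?W" and i: "i \<in> ?W" for q i
  proof -
    note qe = add_edge_in[OF q ab]
    have *: "conj_swap a i (add_edge a b q) b = i" "conj_swap a i (add_edge a b q) a = q i"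
      using conj_swap_apply[OF qe(1) ab(1), of i] i qe(2) qe(4)[of i] ab by auto
    show "?F (q,i) \<in> {y \<in> pairings V. y a \<noteq> b}"
      using * conj_swap_in[OF qe(1) ab(1), of i] i pairings_in[OF q, of i] by auto
    show "?G (?F (q,i)) = (q,i)" using * by simp
  qed
  have G: "?G y \<in> pairings ?W \<times> ?W" "?F (?G y) = y" if y: "y \<in> pairings V" "y a \<noteq> b" for y
  proof -
    have yb: "y b \<in> V" "y b \<noteq> b" "y b \<noteq> a" "y (y b) = b"
      using y ab pairings_neq[OF y(1) ab(2)] pairings_involutive[OF y(1)] by auto
    have "conj_swap a (y b) y a = b"
      using conj_swap_apply[OF y(1) ab(1) yb(1), of a] yb y(2) pairings_eq_iff[OF y(1), of a b] ab by auto
    then have "add_edge a b (conj_swap a (y b) y) \<in> pairings ?W"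
      by (intro remove_edge_in conj_swap_in y ab yb)
    then show "?G y \<in> pairings ?W \<times> ?W" using yb by simp
    show "?F (?G y) = y" by simp
  qed
  have bij: "bij_betw ?F (pairings ?W \<times> ?W) {y \<in> pairings V. y a \<noteq> b}"
  proof (rule bij_betw_byWitness[where f'="?G"])
    show "\<forall>z\<in>pairings ?W \<times> ?W. ?G (?F z) = z"
    proof
      fix z assume "z \<in> pairings ?W \<times> ?W"
      then have "fst z \<in> pairings ?W" "snd z \<in> ?W" by (simp_all only: mem_Times_iff)
      from F(2)[OF this] show "?G (?F z) = z" by (simp only: prod.collapse)
    qed
    show "\<forall>y\<in>{y \<in> pairings V. y a \<noteq> b}. ?F (?G y) = y" using G(2) by simp
    show "?F ` (pairings ?W \<times> ?W) \<subseteq> {y \<in> pairings V. y a \<noteq> b}"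
    proof (rule image_subsetI)
      fix z assume "z \<in> pairings ?W \<times> ?W"
      then have "fst z \<in> pairings ?W" "snd z \<in> ?W" by (simp_all only: mem_Times_iff)
      from F(1)[OF this] show "?F z \<in> {y \<in> pairings V. y a \<noteq> b}" by (simp only: prod.collapse)
    qed
    show "?G ` {y \<in> pairings V. y a \<noteq> b} \<subseteq> pairings ?W \<times> ?W"
    proof (rule image_subsetI)
      fix y assume "y \<in> {y \<in> pairings V. y a \<noteq> b}"
      then show "?G y \<in> pairings ?W \<times> ?W" by (intro G(1)) simp_all
    qed
  qed
  have "(\<Sum>y | y \<in> pairings V \<and> y a \<noteq> b. g y) = (\<Sum>z\<in>pairings ?W \<times> ?W. g (?F z))"
    by (rule sum.reindex_bij_betw[OF bij, of g, symmetric])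
  then show ?thesis by (simp add: sum.cartesian_product case_prod_unfold)
qed

lemma star_add_edge:
  assumes "finite V" and ab: "a \<in> V" "b \<in> V" "a \<noteq> b" and q: "q \<in> pairings (V - {a,b})"
  shows "(\<Sum>i\<in>V-{a,b}. f (conj_swap a i (add_edge a b q))) = star V a f (add_edge a b q) - f (add_edge a b q)"
proof -
  note qe = add_edge_in[OF q ab]
  have "b \<in> V - {a}" "V - {a} - {b} = V - {a,b}" using ab by auto
  then show ?thesis
    unfolding star_def using sum.remove[of "V-{a}" b "\<lambda>i. f (conj_swap a i (add_edge a b q))"]
      conj_swap_partner[OF qe(1) ab(1)] qe(2) assms(1) by simp
qed

text \<open>A pairing that shares \<open>{a, b}\<close> with the given one is not related to it, as
  that edge is a proper closed set. The others are parametrised by a contraction and a switch, and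
  by \<open>ham_contract\<close> the relation does not depend on the switch. Subtracting
  \<open>f\<close> discards the index \<open>i = b\<close>, which changes nothing in the
  pairing.\<close>

lemma ham_op_contract:
  assumes "finite V" and ab: "a \<in> V" "b \<in> V" "a \<noteq> b" and V: "V \<noteq> {a,b}" and x: "x \<in> pairings (V - {a,b})"
  shows "ham_op V f (add_edge a b x)
    = ham_op (V-{a,b}) (\<lambda>q. star V a f (add_edge a b q) - f (add_edge a b q)) x"
proof -
  let ?W = "V - {a,b}" and ?X = "add_edge a b x"
  let ?g = "\<lambda>y. if ham V ?X y then f y else 0"
  note xe = add_edge_in[OF x ab]
  have "ham_op V f ?X = (\<Sum>y | y \<in> pairings V \<and> y a \<noteq> b. ?g y)"
    unfolding ham_op_def
  proof (rule sum.mono_neutral_right)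
    show "\<forall>y\<in>pairings V - {y \<in> pairings V. y a \<noteq> b}. ?g y = 0"
    proof
      fix y assume "y \<in> pairings V - {y \<in> pairings V. y a \<noteq> b}"
      then have y: "y \<in> pairings V" "y a = b" by auto
      have "\<not> ham V ?X y"
        by (rule not_ham_common_edge[OF xe(1) y(1) ab(1)]) (simp_all only: xe(2) y(2) V not_False_eq_True)
      then show "?g y = 0" by (simp only: if_False)
    qed
  qed (use finite_pairings[OF assms(1)] in auto)
  also have "\<dots> = (\<Sum>q\<in>pairings ?W. \<Sum>i\<in>?W. ?g (conj_swap a i (add_edge a b q)))"
    by (rule sum_by_contraction[OF assms(1) ab])
  also have "\<dots> = (\<Sum>q\<in>pairings ?W. if ham ?W x q then (\<Sum>i\<in>?W. f (conj_swap a i (add_edge a b q))) else 0)"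
  proof (rule sum.cong[OF refl])
    fix q assume q: "q \<in> pairings ?W"
    show "(\<Sum>i\<in>?W. ?g (conj_swap a i (add_edge a b q)))
      = (if ham ?W x q then (\<Sum>i\<in>?W. f (conj_swap a i (add_edge a b q))) else 0)"
      using ham_contract[OF ab x q] by simp
  qed
  also have "\<dots> = ham_op ?W (\<lambda>q. star V a f (add_edge a b q) - f (add_edge a b q)) x"
    unfolding ham_op_def
    by (rule sum.cong[OF refl]) (simp only: star_add_edge[OF assms(1) ab])
  finally show ?thesis .
qed

text \<open>This is \<open>(2 n - 2)!!\<close>, the degree of the Hamiltonian relation by
  \<open>ham_op_const\<close>; the norm constant \<open>c\<close> is
  \<open>ham_deg (n - 1)\<close>.\<close>

definition ham_deg :: "nat \<Rightarrow> real" where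
  "ham_deg n = (\<Prod>i\<in>{1..<n}. 2 * real i)"

lemma ham_deg_1 [simp]: "ham_deg (Suc 0) = 1"
  by (simp add: ham_deg_def)

lemma ham_deg_Suc: "n \<ge> 1 \<Longrightarrow> ham_deg (Suc n) = 2 * real n * ham_deg n"
  by (simp add: ham_deg_def prod.atLeastLessThan_Suc)

lemma ham_deg_pos: "ham_deg n > 0"
  unfolding ham_deg_def by (rule prod_pos) auto

text \<open>Contraction turns the constant \<open>c\<close> into \<open>2 * n * c\<close>: on
  \<open>2 * Suc n\<close> vertices \<open>star\<close> has \<open>2 * n + 1\<close> terms, and one
  is subtracted. On two vertices the double edge satisfies \<open>ham\<close>, so the degree starts
  at 1.\<close>

lemma ham_op_const:
  assumes "n \<ge> 1" "finite V" "card V = 2 * n" "p \<in> pairings V"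
  shows "ham_op V (\<lambda>_. c) p = ham_deg n * c"
  using assms
proof (induction n arbitrary: V p c rule: dec_induct)
  case base
  then obtain a b where V: "V = {a,b}" "a \<noteq> b" by (auto simp: card_2_iff)
  have ham: "ham V p p"
    unfolding ham_def
  proof (intro allI impI)
    fix S assume S: "S \<subseteq> V \<and> S \<noteq> {} \<and> p ` S \<subseteq> S \<and> p ` S \<subseteq> S"
    have "p a = b" "p b = a"
      using pairings_neq[OF base(3), of a] pairings_in[OF base(3), of a] 
        pairings_neq[OF base(3), of b] pairings_in[OF base(3), of b] V by auto
    moreover have "p a \<in> S" if "a \<in> S" using S that by auto
    moreover have "p b \<in> S" if "b \<in> S" using S that by auto
    ultimately have "a \<in> S \<longleftrightarrow> b \<in> S" by (simp only:) blast
    moreover have "S \<subseteq> {a,b}" "S \<noteq> {}" using S V by auto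
    ultimately show "S = V" unfolding V(1) by blast
  qed
  have "card (pairings V) = num_pairings 1" using base(2,1) by (rule card_pairings)
  then have "card (pairings V) = 1" by simp
  then obtain r where r: "pairings V = {r}" by (rule card_1_singletonE)
  moreover have "p = r" using base(3) unfolding r by (rule singletonD)
  ultimately have "pairings V = {p}" by (simp only:)
  then show ?case using ham by (simp add: ham_op_def)
next
  case (step n)
  then have "V \<noteq> {}" by auto
  then obtain a where a: "a \<in> V" by auto
  define b where "b = p a"
  have ab: "a \<in> V" "b \<in> V" "a \<noteq> b" using a step.prems pairings_neq[OF step.prems(3) a] by (auto simp: b_def)
  let ?W = "V - {a,b}"
  have W: "finite ?W" "card ?W = 2 * n" using ab step.prems by (auto simp: card_Diff_subset)
  define x where "x = add_edge a b p"
  have x: "x \<in> pairings ?W" unfolding x_def by (rule remove_edge_in) (use step.prems a in \<open>auto simp: b_def\<close>)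
  have p: "p = add_edge a b x" by (simp add: x_def)
  have "V \<noteq> {a,b}" using W step.hyps by auto
  then have "ham_op V (\<lambda>_. c) p = ham_op ?W (\<lambda>q. star V a (\<lambda>_. c) (add_edge a b q) - c) x"
    unfolding p by (intro ham_op_contract step.prems ab x)
  also have "(\<lambda>q. star V a (\<lambda>_. c) (add_edge a b q) - c) = (\<lambda>q. 2 * real n * c)"
    using a step.prems by (simp add: star_def algebra_simps)
  also have "ham_op ?W (\<lambda>q. 2 * real n * c) x = ham_deg n * (2 * real n * c)"
    by (rule step.IH[OF W x])
  finally show ?case using ham_deg_Suc step.hyps by simp
qed

lemma sum_ham_op:
  assumes "n \<ge> 1" "finite V" "card V = 2 * n"
  shows "(\<Sum>p\<in>pairings V. ham_op V f p) = ham_deg n * (\<Sum>p\<in>pairings V. f p)"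
proof -
  have "(\<Sum>p\<in>pairings V. ham_op V f p) = ip V (\<lambda>_. 1) (ham_op V f)" by (simp add: ip_def)
  also have "\<dots> = ip V (ham_op V (\<lambda>_. 1)) f" by (rule ham_op_selfadj)
  also have "\<dots> = ip V (\<lambda>_. ham_deg n) f"
    by (rule ip_cong) (use ham_op_const[OF assms, of _ 1] in auto)
  finally show ?thesis by (simp add: ip_def sum_distrib_left)
qed

section \<open>The norm of the Hamiltonian operator\<close>

text \<open>The operator \<open>J\<close>: subtracting \<open>f p\<close> discards the trivial
  switch \<open>i = p a\<close>, so its spectral bounds are those of \<open>star\<close> shifted by
  1.\<close>

definition swap_op :: "'a set \<Rightarrow> 'a \<Rightarrow> (('a \<Rightarrow> 'a) \<Rightarrow> real) \<Rightarrow> ('a \<Rightarrow> 'a) \<Rightarrow> real" where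
  "swap_op V a f p = star V a f p - f p"

lemma cells_zero_swap_op:
  assumes "finite V" "a \<in> V" "cells_zero V a f"
  shows "cells_zero V a (swap_op V a f)"
  using cells_zero_lin[OF cells_zero_star[OF assms] assms(3), of 1 "-1"]
  by (simp add: swap_op_def[abs_def])

lemma swap_op_lin:
  "swap_op V a (\<lambda>p. c * f p + d * g p) p = c * swap_op V a f p + d * swap_op V a g p"
  by (simp add: swap_op_def star_add star_scale algebra_simps)

lemma swap_op_selfadj:
  assumes "finite V" "a \<in> V"
  shows "ip V f (swap_op V a g) = ip V (swap_op V a f) g"
  unfolding swap_op_def[abs_def] ip_diff_right ip_diff_left star_selfadj[OF assms] ..

text \<open>For a self-adjoint operator with spectrum in \<open>[- \<alpha>, \<beta>]\<close> the product
  \<open>(\<beta> - B) (B + \<alpha>)\<close> is positive semidefinite.\<close>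

lemma swap_op_square:
  assumes fin: "finite V" and crd: "card V = 2 * n" and a: "a \<in> V" and n: "n \<ge> 3"
    and cz: "cells_zero V a f"
  shows "ip V (swap_op V a f) (swap_op V a f)
    \<le> (real n - 3) * ip V f (swap_op V a f) + (real n - 1) * (2 * real n - 4) * ip V f f"
proof -
  define \<alpha> \<beta> where "\<alpha> = real n - 1" and "\<beta> = 2 * real n - 4"
  define g where "g = swap_op V a f"
  define h where "h = swap_op V a g"
  \<comment> \<open>With \<open>B\<close> for \<open>swap_op\<close>, \<open>x\<close> is
    \<open>(\<beta> - B) f\<close> and \<open>y\<close> is \<open>(B + \<alpha>) f\<close>. The
    lower bound at \<open>x\<close> plus the upper bound at \<open>y\<close> gives
    \<open>\<alpha> + \<beta>\<close> times the wanted form, because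
    \<open>(\<beta> - B) + (B + \<alpha>)\<close> is a scalar.\<close>
  define x where "x = (\<lambda>p. \<beta> * f p + (-1) * g p)"
  define y where "y = (\<lambda>p. \<alpha> * f p + 1 * g p)"
  have czg: "cells_zero V a g" unfolding g_def by (rule cells_zero_swap_op[OF fin a cz])
  have czy: "cells_zero V a y" unfolding y_def by (rule cells_zero_lin[OF cz czg])
  have Sx: "swap_op V a x = (\<lambda>p. \<beta> * g p + (-1) * h p)"
    unfolding x_def by (rule ext) (simp only: swap_op_lin g_def h_def)
  have Sy: "swap_op V a y = (\<lambda>p. \<alpha> * g p + 1 * h p)"
    unfolding y_def by (rule ext) (simp only: swap_op_lin g_def h_def)
  have fh: "ip V f h = ip V g g" unfolding h_def g_def by (rule swap_op_selfadj[OF fin a])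
  have lower: "0 \<le> ip V x (swap_op V a x) + \<alpha> * ip V x x"
    using star_lower_bound[OF fin crd a, of x] n 
    by (simp add: swap_op_def[abs_def] ip_diff_right \<alpha>_def algebra_simps)
  have upper: "0 \<le> \<beta> * ip V y y - ip V y (swap_op V a y)"
    using star_upper_bound[OF _ fin crd a czy] n 
    by (simp add: swap_op_def[abs_def] ip_diff_right \<beta>_def algebra_simps)
  have x: "ip V x (swap_op V a x) + \<alpha> * ip V x x
     = \<beta>\<^sup>2 * ip V f g - 2 * \<beta> * ip V g g + ip V g h + \<alpha> * (\<beta>\<^sup>2 * ip V f f - 2 * \<beta> * ip V f g + ip V g g)"
    unfolding Sx unfolding x_def ip_add_left ip_add_right ip_scale_left ip_scale_right fh ip_commute[of V g f]
    by (simp add: power2_eq_square algebra_simps)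
  have y: "\<beta> * ip V y y - ip V y (swap_op V a y)
     = \<beta> * (\<alpha>\<^sup>2 * ip V f f + 2 * \<alpha> * ip V f g + ip V g g) - (\<alpha>\<^sup>2 * ip V f g + 2 * \<alpha> * ip V g g + ip V g h)"
    unfolding Sy unfolding y_def ip_add_left ip_add_right ip_scale_left ip_scale_right fh ip_commute[of V g f]
    by (simp add: power2_eq_square algebra_simps)
  have "0 \<le> (\<alpha> + \<beta>) * (\<alpha> * \<beta> * ip V f f + (\<beta> - \<alpha>) * ip V f g - ip V g g)"
    using add_nonneg_nonneg[OF lower upper] unfolding x y
    by (simp add: power2_eq_square algebra_simps)
  moreover have "\<alpha> + \<beta> > 0" using n by (simp add: \<alpha>_def \<beta>_def)
  ultimately have "0 \<le> \<alpha> * \<beta> * ip V f f + (\<beta> - \<alpha>) * ip V f g - ip V g g"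
    by (simp add: zero_le_mult_iff)
  moreover have "\<beta> - \<alpha> = real n - 3" by (simp add: \<alpha>_def \<beta>_def)
  ultimately show ?thesis by (simp add: g_def \<alpha>_def \<beta>_def)
qed

lemma swap_op_upper:
  assumes "finite V" "card V = 2 * n" "a \<in> V" "n \<ge> 2" "cells_zero V a f"
  shows "ip V f (swap_op V a f) \<le> (2 * real n - 4) * ip V f f"
  using star_upper_bound[OF assms(4,1,2,3,5)]
  by (simp add: swap_op_def[abs_def] ip_diff_right algebra_simps)

text \<open>For \<open>n \<ge> 3\<close> the coefficient \<open>n - 3\<close> in
  \<open>swap_op_square\<close> is nonnegative, so the upper bound can be inserted there; then
  \<open>(n - 3) + (n - 1) = 2 n - 4\<close>.\<close>

lemma swap_op_norm:
  assumes "finite V" "card V = 2 * n" "a \<in> V" "n \<ge> 3" "cells_zero V a f"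
  shows "ip V (swap_op V a f) (swap_op V a f) \<le> (2 * real n - 4)\<^sup>2 * ip V f f"
proof -
  have "(real n - 3) * ip V f (swap_op V a f) \<le> (real n - 3) * ((2 * real n - 4) * ip V f f)"
    using assms(4) by (intro mult_left_mono swap_op_upper[OF assms(1-3) _ assms(5)]) auto
  then show ?thesis
    using swap_op_square[OF assms(1-5)] by (simp add: power2_eq_square algebra_simps)
qed

text \<open>For \<open>n \<ge> 4\<close> the coefficient \<open>n - 3\<close> in
  \<open>swap_op_square\<close> is positive, so attaining the norm forces the inner product of
  \<open>f\<close> and \<open>J f\<close> to its maximum, and then \<open>J f - (2 n - 4) f\<close>
  has norm zero.\<close>

lemma swap_op_norm_eq:
  assumes "finite V" "card V = 2 * n" "a \<in> V" "n \<ge> 4" "cells_zero V a f"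
    and eq: "(2 * real n - 4)\<^sup>2 * ip V f f \<le> ip V (swap_op V a f) (swap_op V a f)"
    and p: "p \<in> pairings V"
  shows "swap_op V a f p = (2 * real n - 4) * f p"
proof -
  define \<beta> where "\<beta> = 2 * real n - 4"
  define g where "g = swap_op V a f"
  have n3: "n \<ge> 3" using assms(4) by simp
  have "(real n - 3) * (\<beta> * ip V f f) \<le> (real n - 3) * ip V f g"
    using swap_op_square[OF assms(1-3) n3 assms(5)] eq
    by (simp add: g_def \<beta>_def power2_eq_square algebra_simps)
  then have fg: "\<beta> * ip V f f \<le> ip V f g" using assms(4) by simp
  then have "\<beta> * (\<beta> * ip V f f) \<le> \<beta> * ip V f g"
    using assms(4) by (intro mult_left_mono) (auto simp: \<beta>_def)
  moreover have "ip V g g \<le> \<beta>\<^sup>2 * ip V f f"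
    unfolding g_def \<beta>_def by (rule swap_op_norm[OF assms(1-3) n3 assms(5)])
  moreover have "ip V (\<lambda>p. g p - \<beta> * f p) (\<lambda>p. g p - \<beta> * f p) = ip V g g - 2 * \<beta> * ip V f g + \<beta>\<^sup>2 * ip V f f"
    unfolding ip_linear ip_commute[of V g f] by (simp add: power2_eq_square algebra_simps)
  ultimately have "ip V (\<lambda>p. g p - \<beta> * f p) (\<lambda>p. g p - \<beta> * f p) \<le> 0"
    by (simp add: power2_eq_square)
  then have "ip V (\<lambda>p. g p - \<beta> * f p) (\<lambda>p. g p - \<beta> * f p) = 0"
    using ip_nonneg[of V "\<lambda>p. g p - \<beta> * f p"] by simp
  from ip_eq_0[OF assms(1) this p] show ?thesis by (simp add: g_def \<beta>_def)
qed

lemma swap_op_split: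
  assumes "finite V" "card V = 2 * n" "a \<in> V" "p \<in> pairings V" "(\<Sum>p\<in>pairings V. f p) = 0"
  shows "swap_op V a f p = swap_op V a (cell_dev V a f) p - cell_avg V a f p"
proof -
  have f: "(\<lambda>p. cell_dev V a f p + cell_avg V a f p) = f" by (simp add: cell_dev_def)
  have "star V a (\<lambda>p. cell_dev V a f p + cell_avg V a f p) p = star V a (cell_dev V a f) p"
    unfolding star_add star_cell_avg[OF assms(1-4)] assms(5) by simp
  then show ?thesis unfolding f by (simp add: swap_op_def cell_dev_def)
qed

lemma ham_op_split:
  assumes "finite V" "card V = 2 * n" "n \<ge> 2" and ab: "a \<in> V" "b \<in> V" "a \<noteq> b"
    and f0: "(\<Sum>p\<in>pairings V. f p) = 0" and x: "x \<in> pairings (V - {a,b})"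
  shows "ham_op V f (add_edge a b x)
    = ham_op (V-{a,b}) (swap_op V a (cell_dev V a f) \<circ> add_edge a b) x - ham_deg (n - 1) * edge_mean V f a b"
proof -
  let ?W = "V - {a,b}"
  have W: "finite ?W" "card ?W = 2 * (n - 1)" using assms by (auto simp: card_Diff_subset)
  have V: "V \<noteq> {a,b}" using assms(2,3) ab(3) by auto
  have n1: "n - 1 \<ge> 1" using assms(3) by simp
  have "ham_op V f (add_edge a b x) = ham_op ?W (\<lambda>q. swap_op V a f (add_edge a b q)) x"
    unfolding ham_op_contract[OF assms(1) ab V x] swap_op_def ..
  also have "\<dots> = ham_op ?W (\<lambda>q. (swap_op V a (cell_dev V a f) \<circ> add_edge a b) q - edge_mean V f a b) x"
  proof (rule ham_op_cong)
    fix q assume q: "q \<in> pairings ?W"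
    note qe = add_edge_in[OF q ab]
    show "swap_op V a f (add_edge a b q) = (swap_op V a (cell_dev V a f) \<circ> add_edge a b) q - edge_mean V f a b"
      using swap_op_split[OF assms(1,2) ab(1) qe(1) f0] qe(2) by (simp add: cell_avg_def)
  qed
  also have "\<dots> = ham_op ?W (swap_op V a (cell_dev V a f) \<circ> add_edge a b) x - ham_op ?W (\<lambda>_. edge_mean V f a b) x"
    by (rule ham_op_diff)
  also have "ham_op ?W (\<lambda>_. edge_mean V f a b) x = ham_deg (n - 1) * edge_mean V f a b"
    by (rule ham_op_const[OF n1 W x])
  finally show ?thesis .
qed

lemma sum_ip_cells:
  assumes "finite V" "a \<in> V"
  shows "ip V f g = (\<Sum>b\<in>V-{a}. ip (V-{a,b}) (f \<circ> add_edge a b) (g \<circ> add_edge a b))"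
  unfolding ip_def sum_by_edge[OF assms] by simp

lemma cell_restrict_sum:
  assumes "a \<in> V" "b \<in> V - {a}" "cells_zero V a f"
  shows "(\<Sum>q\<in>pairings (V-{a,b}). (f \<circ> add_edge a b) q) = 0"
proof -
  have ab: "b \<in> V" "a \<noteq> b" using assms(2) by auto
  have "(\<Sum>p | p \<in> pairings V \<and> p a = b. f p) = 0"
    using assms(3,2) unfolding cells_zero_def by (rule bspec)
  then show ?thesis unfolding sum_through[OF assms(1) ab] by (simp only: comp_def)
qed

text \<open>Pythagoras in each cell: \<open>J\<close> of the deviation sums to zero there, and so
  does its image under the smaller operator by \<open>sum_ham_op\<close>, while the other part is
  constant on the cell.\<close>

lemma ham_op_norm_split:
  assumes "finite V" "card V = 2 * n" "n \<ge> 2" and a: "a \<in> V"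
    and f0: "(\<Sum>p\<in>pairings V. f p) = 0"
  defines "J \<equiv> swap_op V a (cell_dev V a f)"
  shows "ip V (ham_op V f) (ham_op V f)
    = (\<Sum>b\<in>V-{a}. ip (V-{a,b}) (ham_op (V-{a,b}) (J \<circ> add_edge a b)) (ham_op (V-{a,b}) (J \<circ> add_edge a b)))
      + (ham_deg (n - 1))\<^sup>2 * ip V (cell_avg V a f) (cell_avg V a f)"
proof -
  let ?W = "\<lambda>b. V - {a,b}" and ?d = "ham_deg (n - 1)"
  let ?H = "\<lambda>b. ham_op (?W b) (J \<circ> add_edge a b)"
  have J: "cells_zero V a J"
    unfolding J_def by (rule cells_zero_swap_op[OF assms(1) a cells_zero_dev[OF assms(1,2) a]])
  have "ip V (ham_op V f) (ham_op V f) = (\<Sum>b\<in>V-{a}. ip (?W b) (ham_op V f \<circ> add_edge a b) (ham_op V f \<circ> add_edge a b))"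
    by (rule sum_ip_cells[OF assms(1) a])
  also have "\<dots> = (\<Sum>b\<in>V-{a}. ip (?W b) (?H b) (?H b)
      + ?d\<^sup>2 * ip (?W b) (cell_avg V a f \<circ> add_edge a b) (cell_avg V a f \<circ> add_edge a b))"
  proof (rule sum.cong[OF refl])
    fix b assume b: "b \<in> V - {a}"
    then have ab: "a \<in> V" "b \<in> V" "a \<noteq> b" using a by auto
    have W: "finite (?W b)" "card (?W b) = 2 * (n - 1)" "n - 1 \<ge> 1"
      using ab assms by (auto simp: card_Diff_subset)
    let ?e = "edge_mean V f a b"
    have H0: "ip (?W b) (?H b) (\<lambda>_. ?d * ?e) = 0"
      using sum_ham_op[OF W(3,1,2), of "J \<circ> add_edge a b"] cell_restrict_sum[OF a b J]
      by (simp add: ip_def sum_distrib_right[symmetric])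
    have "ip (?W b) (ham_op V f \<circ> add_edge a b) (ham_op V f \<circ> add_edge a b)
      = ip (?W b) (\<lambda>x. ?H b x - ?d * ?e) (\<lambda>x. ?H b x - ?d * ?e)"
      by (rule ip_cong) (simp_all add: ham_op_split[OF assms(1-3) ab f0] J_def)
    also have "\<dots> = ip (?W b) (?H b) (?H b) + ip (?W b) (\<lambda>_. ?d * ?e) (\<lambda>_. ?d * ?e)"
      unfolding ip_diff_left ip_diff_right ip_commute[of "?W b" "\<lambda>_. ?d * ?e" "?H b"] H0 by simp
    also have "ip (?W b) (\<lambda>_. ?d * ?e) (\<lambda>_. ?d * ?e) = ?d\<^sup>2 * ip (?W b) (\<lambda>_. ?e) (\<lambda>_. ?e)"
      by (simp add: ip_def power2_eq_square algebra_simps)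
    also have "ip (?W b) (\<lambda>_. ?e) (\<lambda>_. ?e) = ip (?W b) (cell_avg V a f \<circ> add_edge a b) (cell_avg V a f \<circ> add_edge a b)"
      by (rule ip_cong) (simp_all add: cell_avg_def add_edge_in(2)[OF _ ab])
    finally show "ip (?W b) (ham_op V f \<circ> add_edge a b) (ham_op V f \<circ> add_edge a b)
      = ip (?W b) (?H b) (?H b) + ?d\<^sup>2 * ip (?W b) (cell_avg V a f \<circ> add_edge a b) (cell_avg V a f \<circ> add_edge a b)" .
  qed
  finally show ?thesis
    unfolding sum_ip_cells[OF assms(1) a, of "cell_avg V a f" "cell_avg V a f"] sum_distrib_left sum.distrib .
qed

lemma ham_op_norm_step:
  fixes V :: "'a set"
  assumes "finite V" "card V = 2 * n" "n \<ge> 3" and a: "a \<in> V"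
    and f0: "(\<Sum>p\<in>pairings V. f p) = 0"
    and IH: "\<And>(W :: 'a set) g. \<lbrakk>finite W; card W = 2 * (n - 1); (\<Sum>p\<in>pairings W. g p) = 0\<rbrakk>
      \<Longrightarrow> ip W (ham_op W g) (ham_op W g) \<le> (ham_deg (n - 2))\<^sup>2 * ip W g g"
  defines "J \<equiv> swap_op V a (cell_dev V a f)"
  shows "ip V (ham_op V f) (ham_op V f)
    \<le> (ham_deg (n - 2))\<^sup>2 * ip V J J + (ham_deg (n - 1))\<^sup>2 * ip V (cell_avg V a f) (cell_avg V a f)"
proof -
  let ?W = "\<lambda>b. V - {a,b}"
  let ?J = "\<lambda>b. J \<circ> add_edge a b"
  have n2: "n \<ge> 2" using assms(3) by simp
  have J: "cells_zero V a J"
    unfolding J_def by (rule cells_zero_swap_op[OF assms(1) a cells_zero_dev[OF assms(1,2) a]])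
  have "(\<Sum>b\<in>V-{a}. ip (?W b) (ham_op (?W b) (?J b)) (ham_op (?W b) (?J b)))
      \<le> (\<Sum>b\<in>V-{a}. (ham_deg (n - 2))\<^sup>2 * ip (?W b) (?J b) (?J b))"
  proof (rule sum_mono)
    fix b assume b: "b \<in> V - {a}"
    show "ip (?W b) (ham_op (?W b) (?J b)) (ham_op (?W b) (?J b)) \<le> (ham_deg (n - 2))\<^sup>2 * ip (?W b) (?J b) (?J b)"
      by (rule IH[OF _ _ cell_restrict_sum[OF a b J]]) (use a b assms(1,2) in \<open>auto simp: card_Diff_subset\<close>)
  qed
  also have "\<dots> = (ham_deg (n - 2))\<^sup>2 * ip V J J"
    unfolding sum_ip_cells[OF assms(1) a, of J J] sum_distrib_left ..
  finally show ?thesis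
    using ham_op_norm_split[OF assms(1,2) n2 a f0] unfolding J_def by linarith
qed

lemma ham_deg_rec: "n \<ge> 3 \<Longrightarrow> ham_deg (n - 1) = (2 * real n - 4) * ham_deg (n - 2)"
  using ham_deg_Suc[of "n - 2"] by (simp add: of_nat_diff Suc_diff_le numeral_2_eq_2 Suc_diff_Suc algebra_simps)

section \<open>The base case of four vertices\<close>

lemma cell_dev_4:
  assumes "finite V" "card V = 2 * 2" "a \<in> V" "p \<in> pairings V"
  shows "cell_dev V a f p = 0"
  using cells_zero_4[OF assms(1) _ assms(3) cells_zero_dev[OF assms(1-3)] assms(4), of f] assms(2) by simp

lemma swap_op_dev_4:
  assumes "finite V" "card V = 2 * 2" "a \<in> V" "p \<in> pairings V"
  shows "swap_op V a (cell_dev V a f) p = 0"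
proof -
  have "star V a (cell_dev V a f) p = star V a (\<lambda>_. 0) p"
    by (rule star_cong[OF _ assms(3,4)]) (rule cell_dev_4[OF assms(1-3)])
  then show ?thesis using cell_dev_4[OF assms] by (simp add: swap_op_def star_def)
qed

text \<open>On four vertices any two distinct pairings form a 4-cycle, so the operator is the
  all-ones matrix minus the identity. Here this comes out of \<open>ham_op_split\<close>, in which
  the deviations vanish.\<close>

lemma ham_op_4:
  assumes "finite V" "card V = 2 * 2" "p \<in> pairings V" "(\<Sum>p\<in>pairings V. f p) = 0"
  shows "ham_op V f p = - f p"
proof -
  have "V \<noteq> {}" using assms(2) by auto
  then obtain a where a: "a \<in> V" by blast
  define b where "b = p a"
  have b: "b \<in> V" "a \<noteq> b" 
    using a pairings_neq[OF assms(3) a] pairings_in[OF assms(3), of a] unfolding b_def by simp_all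
  define x where "x = add_edge a b p"
  have x: "x \<in> pairings (V - {a,b})"
    unfolding x_def b_def by (rule remove_edge_in[OF assms(3) refl a])
  have p: "p = add_edge a b x" by (simp add: x_def)
  have "ham_op V f p = ham_op (V-{a,b}) (swap_op V a (cell_dev V a f) \<circ> add_edge a b) x - ham_deg (2 - 1) * edge_mean V f a b"
    unfolding p by (rule ham_op_split[OF assms(1,2) _ a b assms(4) x]) simp
  also have "ham_op (V-{a,b}) (swap_op V a (cell_dev V a f) \<circ> add_edge a b) x = ham_op (V-{a,b}) (\<lambda>_. 0) x"
    by (rule ham_op_cong) (simp add: swap_op_dev_4[OF assms(1,2) a] add_edge_in(1)[OF _ a b])
  also have "\<dots> = 0" by (simp add: ham_op_def)
  also have "edge_mean V f a b = f p"
    using cell_dev_4[OF assms(1,2) a assms(3), of f] by (simp add: cell_dev_def cell_avg_def b_def)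
  finally show ?thesis by simp
qed

lemma ham_op_norm:
  fixes V :: "'a set"
  assumes "n \<ge> 2" "finite V" "card V = 2 * n" "(\<Sum>p\<in>pairings V. f p) = 0"
  shows "ip V (ham_op V f) (ham_op V f) \<le> (ham_deg (n - 1))\<^sup>2 * ip V f f"
  using assms
proof (induction n arbitrary: V f rule: dec_induct)
  case base
  have "ip V (ham_op V f) (ham_op V f) = ip V (\<lambda>p. - f p) (\<lambda>p. - f p)"
    by (rule ip_cong) (rule ham_op_4[OF base(1,2) _ base(3)], assumption)+
  then show ?case by (simp add: ip_def)
next
  case (step n)
  let ?n = "Suc n"
  have n3: "?n \<ge> 3" using step.hyps by simp
  have "V \<noteq> {}" using step.prems(2) by auto
  then obtain a where a: "a \<in> V" by blast
  let ?D = "cell_dev V a f" and ?A = "cell_avg V a f"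
  let ?J = "swap_op V a ?D"
  have IH: "ip W (ham_op W g) (ham_op W g) \<le> (ham_deg (?n - 2))\<^sup>2 * ip W g g"
    if "finite W" "card W = 2 * (?n - 1)" "(\<Sum>p\<in>pairings W. g p) = 0" for W :: "'a set" and g
    using step.IH[of W g] that by simp
  have "ip V ?J ?J \<le> (2 * real ?n - 4)\<^sup>2 * ip V ?D ?D"
    by (rule swap_op_norm[OF step.prems(1,2) a n3 cells_zero_dev[OF step.prems(1,2) a]])
  then have "(ham_deg (?n - 2))\<^sup>2 * ip V ?J ?J \<le> (ham_deg (?n - 2))\<^sup>2 * ((2 * real ?n - 4)\<^sup>2 * ip V ?D ?D)"
    by (intro mult_left_mono) simp_all
  also have "\<dots> = (ham_deg (?n - 1))\<^sup>2 * ip V ?D ?D"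
    unfolding ham_deg_rec[OF n3] by (simp add: power_mult_distrib)
  finally have "(ham_deg (?n - 2))\<^sup>2 * ip V ?J ?J \<le> (ham_deg (?n - 1))\<^sup>2 * ip V ?D ?D" .
  then have "ip V (ham_op V f) (ham_op V f) \<le> (ham_deg (?n - 1))\<^sup>2 * ip V ?D ?D + (ham_deg (?n - 1))\<^sup>2 * ip V ?A ?A"
    using ham_op_norm_step[OF step.prems(1,2) n3 a step.prems(3) IH] by linarith
  also have "\<dots> = (ham_deg (?n - 1))\<^sup>2 * ip V f f"
    unfolding cell_split_norm[OF step.prems(1,2) a, of f] by (simp only: distrib_left)
  finally show ?case .
qed

text \<open>In the norm estimate the average part contributes exactly
  \<open>(ham_deg (n - 1))\<^sup>2\<close> times its squared norm. An eigenfunction that attains the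
  norm therefore forces equality in \<open>swap_op_norm\<close> for the deviation, and
  \<open>swap_op_norm_eq\<close> identifies the eigenvalue of \<open>J\<close>.\<close>

lemma ham_op_eigen_swap:
  fixes V :: "'a set"
  assumes "finite V" "card V = 2 * n" "n \<ge> 3" and a: "a \<in> V"
    and f0: "(\<Sum>p\<in>pairings V. f p) = 0"
    and ev: "\<And>p. p \<in> pairings V \<Longrightarrow> ham_op V f p = - ham_deg (n - 1) * f p"
    and p: "p \<in> pairings V"
  shows "swap_op V a (cell_dev V a f) p = (2 * real n - 4) * cell_dev V a f p"
proof (cases "n = 3")
  \<comment> \<open>The smaller operator is minus the identity on functions with sum zero, so the
    eigenvalue equation can be solved for \<open>J\<close> directly.\<close>
  case True
  define b where "b = p a"
  have b: "b \<in> V" "a \<noteq> b" 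
    using a pairings_neq[OF p a] pairings_in[OF p, of a] unfolding b_def by simp_all
  define x where "x = add_edge a b p"
  have x: "x \<in> pairings (V - {a,b})"
    unfolding x_def b_def by (rule remove_edge_in[OF p refl a])
  have px: "p = add_edge a b x" by (simp add: x_def)
  let ?J = "swap_op V a (cell_dev V a f)"
  have J: "cells_zero V a ?J"
    by (rule cells_zero_swap_op[OF assms(1) a cells_zero_dev[OF assms(1,2) a]])
  have W: "finite (V - {a,b})" "card (V - {a,b}) = 2 * 2"
    using assms(1,2) True a b by (auto simp: card_Diff_subset)
  have bV: "b \<in> V - {a}" using b by auto
  have deg: "ham_deg (n - 1) = 2" using ham_deg_Suc[of 1] True by (simp add: numeral_2_eq_2)
  have "- 2 * f p = ham_op V f p" using ev[OF p] deg by simp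
  also have "\<dots> = ham_op (V-{a,b}) (?J \<circ> add_edge a b) x - 2 * edge_mean V f a b"
    unfolding px deg[symmetric] by (rule ham_op_split[OF assms(1,2) _ a b f0 x]) (use assms(3) in simp)
  also have "ham_op (V-{a,b}) (?J \<circ> add_edge a b) x = - (?J \<circ> add_edge a b) x"
    by (rule ham_op_4[OF W x cell_restrict_sum[OF a bV J]])
  also have "(?J \<circ> add_edge a b) x = ?J p" by (simp only: px comp_def)
  finally have "?J p = 2 * (f p - edge_mean V f a b)" by simp
  then show ?thesis by (simp add: True cell_dev_def cell_avg_def b_def)
next
  case False
  then have n4: "n \<ge> 4" and n2: "n - 1 \<ge> 2" using assms(3) by auto
  let ?D = "cell_dev V a f" and ?A = "cell_avg V a f"
  let ?J = "swap_op V a ?D"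
  have IH: "ip W (ham_op W g) (ham_op W g) \<le> (ham_deg (n - 2))\<^sup>2 * ip W g g"
    if "finite W" "card W = 2 * (n - 1)" "(\<Sum>p\<in>pairings W. g p) = 0" for W :: "'a set" and g
    using ham_op_norm[OF n2 that] by (simp add: numeral_2_eq_2)
  have "ip V (ham_op V f) (ham_op V f) = ip V (\<lambda>p. - ham_deg (n - 1) * f p) (\<lambda>p. - ham_deg (n - 1) * f p)"
    by (rule ip_cong) (rule ev, assumption)+
  also have "\<dots> = (ham_deg (n - 1))\<^sup>2 * ip V f f"
    unfolding ip_scale_left ip_scale_right by (simp add: power2_eq_square)
  also have "\<dots> = (ham_deg (n - 1))\<^sup>2 * ip V ?D ?D + (ham_deg (n - 1))\<^sup>2 * ip V ?A ?A"
    unfolding cell_split_norm[OF assms(1,2) a, of f] by (simp only: distrib_left)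
  finally have "(ham_deg (n - 1))\<^sup>2 * ip V ?D ?D \<le> (ham_deg (n - 2))\<^sup>2 * ip V ?J ?J"
    using ham_op_norm_step[OF assms(1-3) a f0 IH] by linarith
  then have "(ham_deg (n - 2))\<^sup>2 * ((2 * real n - 4)\<^sup>2 * ip V ?D ?D) \<le> (ham_deg (n - 2))\<^sup>2 * ip V ?J ?J"
    unfolding ham_deg_rec[OF assms(3)] by (simp add: power_mult_distrib mult.assoc mult.left_commute)
  then have "(2 * real n - 4)\<^sup>2 * ip V ?D ?D \<le> ip V ?J ?J"
    using ham_deg_pos[of "n - 2"] by simp
  then show ?thesis
    by (rule swap_op_norm_eq[OF assms(1,2) a n4 cells_zero_dev[OF assms(1,2) a] _ p])
qed

lemma ham_op_eigen_star:
  assumes "finite V" "card V = 2 * n" "n \<ge> 3" and a: "a \<in> V"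
    and f0: "(\<Sum>p\<in>pairings V. f p) = 0"
    and ev: "\<And>p. p \<in> pairings V \<Longrightarrow> ham_op V f p = - ham_deg (n - 1) * f p"
    and p: "p \<in> pairings V"
  shows "star V a f p = (2 * real n - 3) * (f p - edge_mean V f a (p a))"
proof -
  have "star V a f p = f p + (swap_op V a (cell_dev V a f) p - cell_avg V a f p)"
    using swap_op_split[OF assms(1,2) a p f0] by (simp add: swap_op_def)
  also have "swap_op V a (cell_dev V a f) p = (2 * real n - 4) * cell_dev V a f p"
    by (rule ham_op_eigen_swap[OF assms])
  finally show ?thesis by (simp add: cell_dev_def cell_avg_def algebra_simps)
qed

section \<open>Extremal families\<close>

lemma num_pairings_real: "n \<ge> 1 \<Longrightarrow> real (num_pairings n) = (2 * real n - 1) * num_pairings (n - 1)"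
  by (cases n) (simp_all add: algebra_simps)

text \<open>Equality in the ratio bound. The indicator \<open>g\<close> of \<open>F\<close> is
  orthogonal to \<open>A g\<close>, so centring at the density \<open>\<mu>\<close> makes the inner
  product of \<open>f\<close> and \<open>A f\<close> equal to \<open>- c\<close> times that of
  \<open>f\<close> with itself. With the norm bound for \<open>A f\<close>, expanding the squared
  norm of \<open>A f + c f\<close> then gives at most 0.\<close>

lemma ham_free_eigen:
  assumes "finite V" "card V = 2 * n" "n \<ge> 2" and F: "F \<subseteq> pairings V"
    and free: "\<forall>p\<in>F. \<forall>q\<in>F. \<not> ham V p q"
    and crd: "card F = num_pairings (n - 1)"
  defines "f \<equiv> \<lambda>p. (if p \<in> F then 1 else 0) - 1 / (2 * real n - 1)"
  shows "(\<Sum>p\<in>pairings V. f p) = 0"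
    and "p \<in> pairings V \<Longrightarrow> ham_op V f p = - ham_deg (n - 1) * f p"
proof -
  define g :: "('a \<Rightarrow> 'a) \<Rightarrow> real" where "g p = (if p \<in> F then 1 else 0)" for p
  define \<mu> where "\<mu> = 1 / (2 * real n - 1)"
  define N where "N = real (card (pairings V))"
  define c where "c = ham_deg (n - 1)"
  define D where "D = ham_deg n"
  have n1: "n \<ge> 1" using assms(3) by simp
  have f: "f = (\<lambda>p. g p - \<mu>)" by (simp add: f_def g_def \<mu>_def)
  have fin: "finite (pairings V)" by (rule finite_pairings[OF assms(1)])
  have N: "\<mu> * N = card F"
    using assms(3) crd card_pairings[OF assms(2,1)] num_pairings_real[OF n1] by (simp add: N_def \<mu>_def)
  \<comment> \<open>The degree is \<open>2 n - 2\<close> times \<open>c\<close>, so both sides are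
    \<open>c * (2 n - 2) / (2 n - 1)\<close>. Here the extremal size makes the ratio bound
    tight.\<close>
  have D: "D * \<mu> = c * (1 - \<mu>)"
  proof -
    have "D = (2 * real n - 2) * c"
      using ham_deg_Suc[of "n - 1"] assms(3) by (simp add: D_def c_def of_nat_diff)
    then show ?thesis using assms(3) by (simp add: \<mu>_def field_simps)
  qed
  have sg: "(\<Sum>p\<in>pairings V. g p) = card F"
    using fin F by (simp add: g_def sum.If_cases Int_absorb1)
  have gg: "ip V g g = card F"
    unfolding sg[symmetric] ip_def by (rule sum.cong) (auto simp: g_def)
  show sf: "(\<Sum>p\<in>pairings V. f p) = 0"
    unfolding f sum_subtractf sg using N by (simp add: N_def mult.commute)
  have ff: "ip V f f = card F * (1 - \<mu>)"
  proof -
    have "ip V f f = ip V f g - \<mu> * (\<Sum>p\<in>pairings V. f p)"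
      unfolding f ip_diff_right by (simp add: ip_def sum_distrib_left mult.commute)
    also have "ip V f g = ip V g g - \<mu> * (\<Sum>p\<in>pairings V. g p)"
      unfolding f ip_diff_left by (simp add: ip_def sum_distrib_left mult.commute)
    finally show ?thesis by (simp add: sf gg sg algebra_simps)
  qed
  have gAg: "ip V g (ham_op V g) = 0"
  proof -
    have *: "g p * ham_op V g p = 0" for p
    proof (cases "p \<in> F")
      case True
      have "ham_op V g p = 0" unfolding ham_op_def
        by (rule sum.neutral) (use free True in \<open>auto simp: g_def\<close>)
      then show ?thesis by simp
    qed (simp add: g_def)
    then show ?thesis unfolding ip_def by (intro sum.neutral ballI)
  qed
  have const: "ip V h (ham_op V (\<lambda>_. \<mu>)) = D * \<mu> * (\<Sum>p\<in>pairings V. h p)" for h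
  proof -
    have "ip V h (ham_op V (\<lambda>_. \<mu>)) = ip V h (\<lambda>_. D * \<mu>)"
      unfolding D_def by (rule ip_cong[OF refl ham_op_const[OF n1 assms(1,2)]])
    then show ?thesis by (simp add: ip_def sum_distrib_left mult.commute)
  qed
  have fAf: "ip V f (ham_op V f) = - c * ip V f f"
  proof -
    have Af: "ham_op V f = (\<lambda>p. ham_op V g p - ham_op V (\<lambda>_. \<mu>) p)"
      unfolding f by (rule ext) (rule ham_op_diff)
    have "ip V f (ham_op V f) = ip V f (ham_op V g) - D * \<mu> * (\<Sum>p\<in>pairings V. f p)"
      unfolding Af ip_diff_right const ..
    also have "ip V f (ham_op V g) = ip V g (ham_op V g) - ip V (ham_op V (\<lambda>_. \<mu>)) g"
      unfolding f ip_diff_left ham_op_selfadj[of V "\<lambda>_. \<mu>"] ..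
    also have "ip V (ham_op V (\<lambda>_. \<mu>)) g = D * \<mu> * card F"
      unfolding ip_commute[of V _ g] const sg ..
    finally show ?thesis unfolding sf gAg ff D by simp
  qed
  have "ip V (\<lambda>p. ham_op V f p + c * f p) (\<lambda>p. ham_op V f p + c * f p)
      = ip V (ham_op V f) (ham_op V f) + 2 * c * ip V f (ham_op V f) + c\<^sup>2 * ip V f f"
    unfolding ip_add_left ip_add_right ip_scale_left ip_scale_right ip_commute[of V "ham_op V f" f]
    by (simp add: power2_eq_square)
  also have "\<dots> \<le> c\<^sup>2 * ip V f f + 2 * c * (- c * ip V f f) + c\<^sup>2 * ip V f f"
    unfolding fAf using ham_op_norm[OF assms(3,1,2) sf] by (simp add: c_def mult.commute)
  also have "\<dots> = 0" by (simp add: power2_eq_square)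
  finally have "ip V (\<lambda>p. ham_op V f p + c * f p) (\<lambda>p. ham_op V f p + c * f p) = 0"
    using ip_nonneg[of V "\<lambda>p. ham_op V f p + c * f p"] by simp
  from ip_eq_0[OF assms(1) this] show "ham_op V f p = - ham_deg (n - 1) * f p" if "p \<in> pairings V" for p
    using that by (simp add: c_def add_eq_0_iff2)
qed

text \<open>This is \<open>ham_op_eigen_star\<close> for the centred indicator. In the difference on
  the right the centring constants cancel; in \<open>star\<close> the \<open>2 n - 1\<close> copies
  of \<open>1 / (2 n - 1)\<close> add up to the summand 1.\<close>

lemma ham_free_count:
  assumes "finite V" "card V = 2 * n" "n \<ge> 3" and F: "F \<subseteq> pairings V"
    and free: "\<forall>p\<in>F. \<forall>q\<in>F. \<not> ham V p q"
    and crd: "card F = num_pairings (n - 1)" and a: "a \<in> V" and p: "p \<in> pairings V"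
  shows "real (card {i \<in> V - {a}. conj_swap a i p \<in> F})
    = 1 + (2 * real n - 3) * ((if p \<in> F then 1 else 0) - card {q \<in> F. q a = p a} / num_pairings (n - 1))"
proof -
  define g :: "('a \<Rightarrow> 'a) \<Rightarrow> real" where "g p = (if p \<in> F then 1 else 0)" for p
  define \<mu> where "\<mu> = 1 / (2 * real n - 1)"
  have n2: "n \<ge> 2" using assms(3) by simp
  have f: "(\<lambda>p. (if p \<in> F then 1 else 0) - 1 / (2 * real n - 1)) = (\<lambda>p. g p - \<mu>)"
    by (simp add: g_def \<mu>_def)
  note fe = ham_free_eigen[OF assms(1,2) n2 F free crd, unfolded f]
  have ev: "ham_op V (\<lambda>p. g p - \<mu>) q = - ham_deg (n - 1) * (g q - \<mu>)" if "q \<in> pairings V" for q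
    using fe(2)[OF that] by (simp add: g_def \<mu>_def)
  have b: "p a \<in> V" "a \<noteq> p a"
    using a pairings_neq[OF p a] pairings_in[OF p, of a] by simp_all
  have star: "star V a (\<lambda>p. g p - \<mu>) p = real (card {i \<in> V - {a}. conj_swap a i p \<in> F}) - 1"
  proof -
    have "star V a (\<lambda>p. g p - \<mu>) p = (\<Sum>i\<in>V-{a}. g (conj_swap a i p)) - real (card (V - {a})) * \<mu>"
      by (simp add: star_def sum_subtractf)
    also have "(\<Sum>i\<in>V-{a}. g (conj_swap a i p)) = (\<Sum>i | i \<in> V - {a} \<and> conj_swap a i p \<in> F. 1)"
      unfolding g_def using assms(1) by (subst sum.inter_filter) simp_all
    also have "real (card (V - {a})) * \<mu> = 1"
      using a assms(1-3) by (simp add: \<mu>_def of_nat_diff)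
    finally show ?thesis by simp
  qed
  have mean: "edge_mean V (\<lambda>p. g p - \<mu>) a (p a) = card {q \<in> F. q a = p a} / num_pairings (n - 1) - \<mu>"
  proof -
    have "(\<Sum>q | q \<in> pairings V \<and> q a = p a. g q - \<mu>) = (\<Sum>q | q \<in> pairings V \<and> q a = p a. g q) - num_pairings (n - 1) * \<mu>"
      using card_through[OF assms(1,2) a b] by (simp add: sum_subtractf)
    also have "(\<Sum>q | q \<in> pairings V \<and> q a = p a. g q) = (\<Sum>q | q \<in> F \<and> q a = p a. 1)"
      by (rule sum.mono_neutral_cong_right) (use F finite_pairings[OF assms(1)] in \<open>auto simp: g_def\<close>)
    finally show ?thesis
      unfolding edge_mean_def card_through[OF assms(1,2) a b]
      using num_pairings_pos[of "n - 1"] by (simp add: diff_divide_distrib)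
  qed
  have "star V a (\<lambda>p. g p - \<mu>) p = (2 * real n - 3) * (g p - \<mu> - edge_mean V (\<lambda>p. g p - \<mu>) a (p a))"
    by (rule ham_op_eigen_star[OF assms(1-3) a fe(1) ev p])
  then show ?thesis unfolding star mean by (simp add: g_def)
qed

text \<open>The three pairings on the four vertices \<open>a\<close>, \<open>p a\<close>,
  \<open>j\<close>, \<open>p j\<close> are switches of each other at \<open>a\<close>, so two
  different switches of \<open>p\<close> can be compared directly.\<close>

lemma conj_swap_triangle:
  assumes p: "p \<in> pairings V" and "a \<in> V" "j \<in> V" "j \<noteq> a" "j \<noteq> p a"
  shows "conj_swap a (p a) (conj_swap a (p j) p) = conj_swap a j p"
proof
  fix v
  define b i where "b = p a" and "i = p j"
  have pp: "p a = b" "p b = a" "p j = i" "p i = j"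
    by (simp_all add: b_def i_def pairings_involutive[OF p])
  have V: "b \<in> V" "i \<in> V" using assms pairings_in[OF p] by (simp_all add: b_def i_def)
  have ne: "a \<noteq> b" "i \<noteq> j" "j \<noteq> a" "j \<noteq> b" "i \<noteq> b" "i \<noteq> a"
    using assms pairings_neq[OF p] pairings_eq_iff[OF p, of j a] pairings_involutive[OF p, of j] 
    unfolding b_def i_def by metis+
  define z where "z = conj_swap a i p"
  have z: "z \<in> pairings V" unfolding z_def by (rule conj_swap_in[OF p assms(2) V(2)])
  have zv: "z v = (if v = a then j else if v = i then b else if v = b then i else if v = j then a else p v)" for v
    unfolding z_def using conj_swap_apply[OF p assms(2) V(2), of v] pp ne by simp
  have "conj_swap a b z v = (if v = a then i else if v = b then j else if v = j then b else if v = i then a else z v)"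
    using conj_swap_apply[OF z assms(2) V(1), of v] zv[of a] zv[of b] ne by simp
  moreover have "conj_swap a j p v = (if v = a then i else if v = j then b else if v = b then j else if v = i then a else p v)"
    using conj_swap_apply[OF p assms(2,3), of v] pp ne by simp
  ultimately show "conj_swap a (p a) (conj_swap a (p j) p) v = conj_swap a j p v"
    unfolding b_def[symmetric] i_def[symmetric] z_def[symmetric] using zv[of v] ne by simp
qed

text \<open>If no star lies in \<open>F\<close>, every edge lies in a non-member, whose switch count
  is a natural number. This restricts the scaled densities \<open>d a b\<close> to 0 and 1 and
  leaves at each \<open>a\<close> a set \<open>Z a\<close> of two vertices never matched to
  \<open>a\<close> by members. Every member must match these two with each other, and since every
  vertex lies in some \<open>Z a\<close>, there is at most one member.\<close>

lemma ham_free_star: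
  assumes fin: "finite V" and crdV: "card V = 2 * n" and n: "n \<ge> 3" and F: "F \<subseteq> pairings V"
    and free: "\<forall>p\<in>F. \<forall>q\<in>F. \<not> ham V p q"
    and crd: "card F = num_pairings (n - 1)"
  shows "\<exists>a\<in>V. \<exists>b\<in>V. a \<noteq> b \<and> {p \<in> pairings V. p a = b} \<subseteq> F"
proof (rule ccontr)
  assume "\<not> ?thesis"
  then have no_star: "\<exists>p\<in>pairings V. p a = b \<and> p \<notin> F" if "a \<in> V" "b \<in> V" "a \<noteq> b" for a b
    using that by blast
  define N where "N = real (num_pairings (n - 1))"
  define cnt where "cnt a p = card {i \<in> V - {a}. conj_swap a i p \<in> F}" for a p
  define d where "d a b = (2 * real n - 3) * (real (card {q \<in> F. q a = b}) / N)" for a b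
  have N: "N > 0" using num_pairings_pos by (simp add: N_def)
  have finF: "finite F" using F finite_pairings[OF fin] by (rule finite_subset)
  have cnt_in: "real (cnt a p) = 2 * real n - 2 - d a (p a)" if "a \<in> V" "p \<in> F" for a p
  proof -
    have "p \<in> pairings V" using that(2) F by (rule subsetD[rotated])
    from ham_free_count[OF fin crdV n F free crd that(1) this] that(2) show ?thesis
      by (simp add: cnt_def d_def N_def right_diff_distrib)
  qed
  have cnt_out: "real (cnt a p) = 1 - d a (p a)" if "a \<in> V" "p \<in> pairings V" "p \<notin> F" for a p
    using ham_free_count[OF fin crdV n F free crd that(1,2)] that(3) by (simp add: cnt_def d_def N_def)
  \<comment> \<open>The count \<open>1 - d a b\<close> at a non-member through \<open>{a, b}\<close>
    is a natural number, and \<open>d a b\<close> is nonnegative.\<close>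
  have d01: "d a b = 0 \<or> d a b = 1" if ab: "a \<in> V" "b \<in> V" "a \<noteq> b" for a b
  proof -
    obtain p where p: "p \<in> pairings V" "p a = b" "p \<notin> F" using no_star[OF ab] by blast
    have c: "real (cnt a p) = 1 - d a b" using cnt_out[OF ab(1) p(1,3)] unfolding p(2) .
    have "d a b \<ge> 0" using N n by (simp add: d_def)
    then have "cnt a p \<le> 1" using c by linarith
    then have "cnt a p = 0 \<or> cnt a p = 1" by arith
    then show ?thesis using c by auto
  qed
  have d0: "d a b = 0 \<longleftrightarrow> {q \<in> F. q a = b} = {}" for a b
    using N n finF by (simp add: d_def)
  have d_pos: "d a (p a) = 1" if "a \<in> V" "p \<in> F" for a p
  proof -
    have p: "p \<in> pairings V" using that(2) F by (rule subsetD[rotated])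
    have "p a \<in> V" "a \<noteq> p a" using that(1) pairings_in[OF p, of a] pairings_neq[OF p that(1)] by simp_all
    from d01[OF that(1) this] d0[of a "p a"] that show ?thesis by blast
  qed
  define Z where "Z a = {b \<in> V - {a}. d a b = 0}" for a
  have Z_sym: "b \<in> Z a \<longleftrightarrow> a \<in> Z b" if "a \<in> V" "b \<in> V" for a b
  proof -
    have "{q \<in> F. q a = b} = {q \<in> F. q b = a}"
    proof (rule Collect_cong, rule conj_cong[OF refl])
      fix q assume "q \<in> F"
      then have "q \<in> pairings V" using F by (rule subsetD[rotated])
      then show "q a = b \<longleftrightarrow> q b = a" by (rule pairings_flip)
    qed
    then have "d a b = d b a" by (simp add: d_def)
    then show ?thesis using that by (auto simp: Z_def)
  qed
  \<comment> \<open>The values \<open>d a b\<close> are 0 or 1 and sum to \<open>2 n - 3\<close>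
    over the \<open>2 n - 1\<close> choices of \<open>b\<close>.\<close>
  have card_Z: "card (Z a) = 2" if a: "a \<in> V" for a
  proof -
    have "(\<Sum>b\<in>V-{a}. d a b) = (2 * real n - 3) / N * (\<Sum>b\<in>V-{a}. real (card {q \<in> F. q a = b}))"
      by (simp add: d_def sum_distrib_left)
    also have "(\<Sum>b\<in>V-{a}. real (card {q \<in> F. q a = b})) = real (card F)"
    proof -
      have im: "(\<lambda>q. q a) ` F \<subseteq> V - {a}"
      proof (rule image_subsetI)
        fix q assume "q \<in> F"
        then have q: "q \<in> pairings V" using F by (rule subsetD[rotated])
        show "q a \<in> V - {a}" using a pairings_in[OF q, of a] pairings_neq[OF q a] by simp
      qed
      show ?thesis
        using sum.group[OF finF _ im, of "\<lambda>_. 1::nat"] fin by (simp flip: of_nat_sum)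
    qed
    finally have s: "(\<Sum>b\<in>V-{a}. d a b) = 2 * real n - 3"
      using N by (simp add: crd N_def)
    have "(\<Sum>b\<in>V-{a}. 1 - d a b) = (\<Sum>b\<in>V-{a}. if d a b = 0 then 1 else 0)"
    proof (rule sum.cong[OF refl])
      fix b assume "b \<in> V - {a}"
      then have "d a b = 0 \<or> d a b = 1" by (intro d01 a) auto
      then show "1 - d a b = (if d a b = 0 then 1 else 0)" by auto
    qed
    also have "\<dots> = real (card (Z a))"
      unfolding Z_def using fin by (simp flip: sum.inter_filter)
    also have "(\<Sum>b\<in>V-{a}. 1 - d a b) = 2"
      unfolding sum_subtractf s using a fin crdV n by (simp add: of_nat_diff)
    finally show ?thesis by simp
  qed
  have partner_Z: "p j \<in> Z a" if a: "a \<in> V" and pF: "p \<in> F" and j: "j \<in> Z a" for a p j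
  proof (rule ccontr)
    assume npj: "p j \<notin> Z a"
    have p: "p \<in> pairings V" using pF F by (rule subsetD[rotated])
    let ?B = "{i \<in> V - {a}. conj_swap a i p \<notin> F}"
    \<comment> \<open>As \<open>d a (p a) = 1\<close>, exactly \<open>2 n - 3\<close> of the
      \<open>2 n - 1\<close> indices keep the member \<open>p\<close> inside
      \<open>F\<close>.\<close>
    have B: "card ?B = 2"
    proof -
      have "V - {a} = {i \<in> V - {a}. conj_swap a i p \<in> F} \<union> ?B" by blast
      then have "card (V - {a}) = card ({i \<in> V - {a}. conj_swap a i p \<in> F} \<union> ?B)" by (simp only:)
      also have "\<dots> = cnt a p + card ?B"
        unfolding cnt_def by (rule card_Un_disjoint) (use fin in auto)
      finally have "real (2 * n - 1) = real (cnt a p) + real (card ?B)"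
        using a fin crdV by simp
      then show ?thesis using cnt_in[OF a pF] d_pos[OF a pF] n by (simp add: of_nat_diff)
    qed
    \<comment> \<open>Switching with \<open>p k\<close> matches \<open>a\<close> to
      \<open>k\<close>, which no member does. This accounts for both indices in
      \<open>?B\<close>.\<close>
    have Zk: "k \<in> V" "k \<noteq> a" "p k \<in> V" "p k \<noteq> a" "k \<noteq> p a"
        "conj_swap a (p k) p a = k" "conj_swap a (p k) p \<in> pairings V" "conj_swap a (p k) p \<notin> F" 
      if k: "k \<in> Z a" for k
    proof -
      show kV: "k \<in> V" "k \<noteq> a" using k by (auto simp: Z_def)
      show pk: "p k \<in> V" using kV pairings_in[OF p, of k] by simp
      have dk: "d a k = 0" using k by (simp add: Z_def)
      then show kpa: "k \<noteq> p a" using d_pos[OF a pF] by auto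
      then show pka: "p k \<noteq> a" using pairings_involutive[OF p, of k] by auto
      have "p a \<noteq> p k" using kV pairings_eq_iff[OF p, of a k] by simp
      then show ck: "conj_swap a (p k) p a = k"
        using conj_swap_apply[OF p a pk, of a] pka pairings_involutive[OF p, of k] by simp
      show "conj_swap a (p k) p \<in> pairings V" by (rule conj_swap_in[OF p a pk])
      show "conj_swap a (p k) p \<notin> F" using dk ck d0[of a k] by blast
    qed
    have "p ` Z a \<subseteq> ?B"
      by (rule image_subsetI) (use Zk in simp)
    moreover have "card (p ` Z a) = 2"
      using card_Z[OF a] by (subst card_image) (auto simp: inj_on_def pairings_eq_iff[OF p])
    ultimately have B_eq: "p ` Z a = ?B"
      using B fin by (intro card_subset_eq) auto
    have "j \<notin> p ` Z a"
    proof
      assume "j \<in> p ` Z a"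
      then obtain k where "k \<in> Z a" "j = p k" by blast
      then show False using npj pairings_involutive[OF p, of k] by simp
    qed
    then have jF: "conj_swap a j p \<in> F" unfolding B_eq using Zk(1,2)[OF j] by blast
    \<comment> \<open>\<open>z\<close> matches \<open>a\<close> to \<open>j\<close>, so
      \<open>d a (z a) = 0\<close> and just one index may switch \<open>z\<close> into
      \<open>F\<close>. Yet \<open>p j\<close> leads back to \<open>p\<close>, and
      \<open>p a\<close> leads to \<open>conj_swap a j p\<close>, both members.\<close>
    define z where "z = conj_swap a (p j) p"
    have "real (cnt a z) = 1 - d a (z a)"
      unfolding z_def by (rule cnt_out[OF a Zk(7,8)[OF j]])
    also have "d a (z a) = 0" unfolding z_def Zk(6)[OF j] using j by (simp add: Z_def)
    finally have "cnt a z = 1" by simp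
    moreover have "{p j, p a} \<subseteq> {i \<in> V - {a}. conj_swap a i z \<in> F}"
    proof -
      have "p a \<in> V" "p a \<noteq> a" using a pairings_in[OF p, of a] pairings_neq[OF p a] by simp_all
      moreover have "conj_swap a (p a) z \<in> F"
        unfolding z_def conj_swap_triangle[OF p a Zk(1,2,5)[OF j]] by (rule jF)
      moreover have "conj_swap a (p j) z \<in> F" using pF by (simp add: z_def)
      ultimately show ?thesis using Zk(3,4)[OF j] by simp
    qed
    then have "card {p j, p a} \<le> cnt a z" unfolding cnt_def using fin by (intro card_mono) auto
    moreover have "p j \<noteq> p a" using Zk(2)[OF j] pairings_eq_iff[OF p, of j a] by simp
    ultimately show False by simp
  qed
  \<comment> \<open>By symmetry of \<open>Z\<close> every \<open>v\<close> lies in some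
    \<open>Z a\<close>. Members map the pair \<open>Z a\<close> to itself without fixed points, so
    they send \<open>v\<close> to the other vertex of that pair.\<close>
  have unique: "p = q" if pF: "p \<in> F" and qF: "q \<in> F" for p q
  proof
    fix v
    have p: "p \<in> pairings V" and q: "q \<in> pairings V" using pF qF F by auto
    show "p v = q v"
    proof (cases "v \<in> V")
      case True
      have "Z v \<noteq> {}" using card_Z[OF True] by auto
      then obtain a where a: "a \<in> Z v" by blast
      then have aV: "a \<in> V" by (simp add: Z_def)
      have v: "v \<in> Z a" using Z_sym[OF aV True] a by simp
      have "card (Z a - {v}) = 1" using card_Z[OF aV] v by simp
      then obtain w where "Z a - {v} = {w}" by (rule card_1_singletonE)
      moreover have "p v \<in> Z a - {v}" "q v \<in> Z a - {v}"
        using partner_Z[OF aV pF v] partner_Z[OF aV qF v] pairings_neq[OF p True] pairings_neq[OF q True] by simp_all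
      ultimately have "p v = w" "q v = w" by (simp_all only: singleton_iff)
      then show ?thesis by simp
    next
      case False
      then show ?thesis using pairings_out[OF p] pairings_out[OF q] by simp
    qed
  qed
  have "card F \<le> 1"
    using unique finF by (simp add: card_le_Suc0_iff_eq)
  moreover have "num_pairings (n - 1) \<ge> 3"
  proof -
    define m where "m = n - 3"
    then have "n - 1 = Suc (Suc m)" using n by simp
    moreover have "num_pairings (Suc (Suc m)) = (2 * m + 3) * num_pairings (Suc m)" by (simp add: algebra_simps)
    moreover have "(2 * m + 3) * num_pairings (Suc m) \<ge> 3 * 1"
    proof (rule mult_le_mono)
      show "1 \<le> num_pairings (Suc m)"
        using num_pairings_pos[of "Suc m"] unfolding One_nat_def by (rule Suc_leI)
    qed simp
    ultimately show ?thesis by (simp only: mult_1_right)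
  qed
  ultimately show False using crd by simp
qed

theorem ham_free_max:
  assumes fin: "finite V" and crdV: "card V = 2 * n" and n: "n \<ge> 2" and F: "F \<subseteq> pairings V"
    and free: "\<forall>p\<in>F. \<forall>q\<in>F. \<not> ham V p q"
    and crd: "card F = num_pairings (n - 1)"
  shows "\<exists>a\<in>V. \<exists>b\<in>V. a \<noteq> b \<and> F = {p \<in> pairings V. p a = b}"
proof -
  have finF: "finite F" using F finite_pairings[OF fin] by (rule finite_subset)
  have "\<exists>a\<in>V. \<exists>b\<in>V. a \<noteq> b \<and> {p \<in> pairings V. p a = b} \<subseteq> F"
  proof (cases "n = 2")
    \<comment> \<open>On four vertices a star is a single pairing, so any one-element family is a
      star.\<close>
    case True
    then have "card F = 1" using crd by simp
    then obtain p where Fp: "F = {p}" by (rule card_1_singletonE)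
    then have p: "p \<in> pairings V" using F by simp
    have "V \<noteq> {}" using crdV n by auto
    then obtain a where a: "a \<in> V" by blast
    have b: "p a \<in> V" "a \<noteq> p a" using a pairings_in[OF p, of a] pairings_neq[OF p a] by simp_all
    have "card {q \<in> pairings V. q a = p a} = 1"
      using card_through[OF fin crdV a b] True by simp
    then obtain r where r: "{q \<in> pairings V. q a = p a} = {r}" by (rule card_1_singletonE)
    moreover have "p \<in> {q \<in> pairings V. q a = p a}" using p by simp
    ultimately have "{q \<in> pairings V. q a = p a} \<subseteq> F" unfolding Fp by (simp only: singleton_iff subset_refl)
    then show ?thesis using a b by blast
  next
    case False
    then show ?thesis using ham_free_star[OF fin crdV _ F free crd] n by simp
  qed
  then obtain a b where ab: "a \<in> V" "b \<in> V" "a \<noteq> b" and sub: "{p \<in> pairings V. p a = b} \<subseteq> F"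
    by blast
  have "{p \<in> pairings V. p a = b} = F"
    by (rule card_subset_eq[OF finF sub]) (simp only: card_through[OF fin crdV ab] crd)
  then show ?thesis using ab by blast
qed

section \<open>Perfect matchings as edge sets\<close>

definition pairing_edges :: "'a set \<Rightarrow> ('a \<Rightarrow> 'a) \<Rightarrow> 'a set set" where
  "pairing_edges V p = (\<lambda>v. {v, p v}) ` V"

lemma pairing_edges_iff:
  assumes "p \<in> pairings V" "i \<in> V"
  shows "{i, j} \<in> pairing_edges V p \<longleftrightarrow> p i = j"
proof
  assume "{i, j} \<in> pairing_edges V p"
  then obtain v where v: "v \<in> V" "{i, j} = {v, p v}" by (auto simp: pairing_edges_def)
  then have "(i = v \<and> j = p v) \<or> (i = p v \<and> j = v)" by (simp only: doubleton_eq_iff)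
  then show "p i = j" using pairings_involutive[OF assms(1), of v] by metis
next
  assume "p i = j"
  then show "{i, j} \<in> pairing_edges V p" using assms(2) by (auto simp: pairing_edges_def)
qed

lemma pairing_edges_matching:
  assumes p: "p \<in> pairings V"
  shows "pairing_edges V p \<in> perfect_matchings V (complete_edges V)"
proof -
  have "pairing_edges V p \<subseteq> complete_edges V"
    unfolding pairing_edges_def
  proof (rule image_subsetI)
    fix v assume v: "v \<in> V"
    show "{v, p v} \<in> complete_edges V"
      using v pairings_in[OF p, of v] pairings_neq[OF p v] by (simp add: complete_edges_def)
  qed
  moreover have "disjoint (pairing_edges V p)"
  proof (rule disjointI)
    fix e e' assume "e \<in> pairing_edges V p" "e' \<in> pairing_edges V p" and ne: "e \<noteq> e'"
    then obtain v w where vw: "e = {v, p v}" "e' = {w, p w}" by (auto simp: pairing_edges_def)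
    show "e \<inter> e' = {}"
    proof (rule ccontr)
      assume "e \<inter> e' \<noteq> {}"
      then have "v = w \<or> v = p w \<or> p v = w \<or> p v = p w" unfolding vw by blast
      then have "v = w \<or> v = p w"
        using pairings_involutive[OF p, of v] pairings_eq_iff[OF p, of v w] by metis
      then show False using ne pairings_involutive[OF p, of w] unfolding vw by auto
    qed
  qed
  moreover have "\<Union> (pairing_edges V p) = V"
  proof
    show "\<Union> (pairing_edges V p) \<subseteq> V"
      unfolding pairing_edges_def by (rule UN_least) (simp add: pairings_in[OF p])
    show "V \<subseteq> \<Union> (pairing_edges V p)" by (auto simp: pairing_edges_def)
  qed
  ultimately show ?thesis by (simp add: perfect_matchings_def)
qed

lemma pairing_edges_inj: "inj_on (pairing_edges V) (pairings V)"
proof (rule inj_onI)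
  fix p q assume p: "p \<in> pairings V" and q: "q \<in> pairings V" and eq: "pairing_edges V p = pairing_edges V q"
  show "p = q"
  proof
    fix v
    show "p v = q v"
    proof (cases "v \<in> V")
      case True
      then show ?thesis
        using pairing_edges_iff[OF p True, of "p v"] pairing_edges_iff[OF q True, of "p v"] eq by simp
    next
      case False
      then show ?thesis using pairings_out[OF p] pairings_out[OF q] by simp
    qed
  qed
qed

text \<open>Covering gives every vertex an edge and disjointness makes it unique, so the partner is
  well defined and taking it is an involution.\<close>

lemma pairing_edges_surj:
  assumes M: "M \<in> perfect_matchings V (complete_edges V)"
  shows "\<exists>p\<in>pairings V. pairing_edges V p = M"
proof -
  have sub: "M \<subseteq> complete_edges V" and disj: "disjoint M" and un: "\<Union> M = V"
    using M by (simp_all add: perfect_matchings_def)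
  have edge: "u \<in> V" "w \<in> V" "u \<noteq> w" if "{u, w} \<in> M" for u w
    using subsetD[OF sub that] by (auto simp: complete_edges_def)
  have ex: "\<exists>w. {v, w} \<in> M" if "v \<in> V" for v
  proof -
    obtain e where e: "e \<in> M" "v \<in> e" using \<open>v \<in> V\<close> un by blast
    then have "card e = 2" using sub by (auto simp: complete_edges_def)
    then obtain x y where "e = {x, y}" by (auto simp: card_2_iff)
    then have "e = {v, y} \<or> e = {v, x}" using e(2) by auto
    then show ?thesis using e(1) by metis
  qed
  have uniq: "w = w'" if "{v, w} \<in> M" "{v, w'} \<in> M" for v w w'
  proof -
    have "{v, w} \<inter> {v, w'} \<noteq> {}" by blast
    then have "{v, w} = {v, w'}" using disjointD[OF disj that] by blast
    then show ?thesis by (auto simp: doubleton_eq_iff)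
  qed
  define p where "p v = (if v \<in> V then (THE w. {v, w} \<in> M) else v)" for v
  have pM: "{v, p v} \<in> M" if "v \<in> V" for v
    unfolding p_def using that ex[OF that] theI'[of "\<lambda>w. {v, w} \<in> M"] uniq[of v] by auto
  have pp: "p (p v) = v" if "v \<in> V" for v
  proof (rule uniq[of "p v"])
    show "{p v, p (p v)} \<in> M" by (rule pM) (rule edge(2)[OF pM[OF that]])
    show "{p v, v} \<in> M" using pM[OF that] by (simp add: insert_commute)
  qed
  have p: "p \<in> pairings V"
    unfolding pairings_def mem_Collect_eq
  proof (intro conjI allI ballI impI)
    show "p v = v" if "v \<notin> V" for v using that by (simp add: p_def)
    fix v assume v: "v \<in> V"
    show "p v \<in> V" "p v \<noteq> v" using edge[OF pM[OF v]] by simp_all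
    show "p (p v) = v" by (rule pp[OF v])
  qed
  have "pairing_edges V p = M"
  proof
    show "pairing_edges V p \<subseteq> M"
      unfolding pairing_edges_def by (rule image_subsetI) (rule pM)
    show "M \<subseteq> pairing_edges V p"
    proof
      fix e assume e: "e \<in> M"
      then have "card e = 2" using sub by (auto simp: complete_edges_def)
      then obtain x y where xy: "e = {x, y}" by (auto simp: card_2_iff)
      then have x: "x \<in> V" "{x, y} \<in> M" using edge[of x y] e by simp_all
      then have "p x = y" using uniq[OF pM[OF x(1)] x(2)] by simp
      then show "e \<in> pairing_edges V p" unfolding xy using x(1) by (simp add: pairing_edges_iff[OF p])
    qed
  qed
  then show ?thesis using p by blast
qed

lemma pairing_edges_bij:
  "bij_betw (pairing_edges V) (pairings V) (perfect_matchings V (complete_edges V))"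
proof (rule bij_betw_imageI[OF pairing_edges_inj])
  show "pairing_edges V ` pairings V = perfect_matchings V (complete_edges V)"
  proof
    show "pairing_edges V ` pairings V \<subseteq> perfect_matchings V (complete_edges V)"
      by (rule image_subsetI) (rule pairing_edges_matching)
    show "perfect_matchings V (complete_edges V) \<subseteq> pairing_edges V ` pairings V"
      using pairing_edges_surj by blast
  qed
qed

text \<open>The set of vertices reachable from \<open>u\<close> is closed under both involutions, so
  \<open>ham\<close> makes it the whole vertex set.\<close>

lemma ham_imp_connected:
  assumes n: "n \<ge> 1" and p: "p \<in> pairings {1..2*n}" and q: "q \<in> pairings {1..2*n}"
    and ham: "ham {1..2*n} p q"
  shows "Digraph_Component.connected (matching_union n (pairing_edges {1..2*n} p) (pairing_edges {1..2*n} q))"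
proof -
  let ?V = "{1..2*n}"
  let ?x = "pairing_edges ?V p" and ?y = "pairing_edges ?V q"
  let ?G = "mk_symmetric (matching_union n ?x ?y)"
  have verts: "pverts ?G = ?V" by (simp add: matching_union_def multigraph_def)
  have fin: "finite ?x" "finite ?y" by (simp_all add: pairing_edges_def)
  have arc: "(v, r v) \<in> parcs ?G" if "v \<in> ?V" "r = p \<or> r = q" for v r
  proof -
    have "{v, r v} \<in> ?x \<or> {v, r v} \<in> ?y" using that by (auto simp: pairing_edges_def)
    then have "0 < count (mset_set ?x + mset_set ?y) {v, r v}" using fin by auto
    then have "((v, r v), 0) \<in> arcs (matching_union n ?x ?y)"
      by (simp add: matching_union_def multigraph_def)
    then show ?thesis
      unfolding parcs_mk_symmetric by (rule UN_I) (simp add: matching_union_def multigraph_def)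
  qed
  have reach: "u \<rightarrow>\<^sup>*\<^bsub>?G\<^esub> v" if u: "u \<in> ?V" and v: "v \<in> ?V" for u v
  proof -
    define S where "S = {v \<in> ?V. (u, v) \<in> rtrancl_on ?V (parcs ?G)}"
    have closed: "r ` S \<subseteq> S" if r: "r = p \<or> r = q" for r
    proof (rule image_subsetI)
      fix w assume w: "w \<in> S"
      then have wV: "w \<in> ?V" by (simp add: S_def)
      have rV: "r w \<in> ?V" using r wV pairings_in[OF p, of w] pairings_in[OF q, of w] by blast
      have "(u, w) \<in> rtrancl_on ?V (parcs ?G)" using w by (simp add: S_def)
      then have "(u, r w) \<in> rtrancl_on ?V (parcs ?G)"
        using arc[OF wV r] rV by (rule rtrancl_on_into_rtrancl_on)
      then show "r w \<in> S" using rV by (simp add: S_def)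
    qed
    have "S = ?V"
    proof (rule hamD[OF ham])
      show "S \<subseteq> ?V" by (auto simp: S_def)
      show "S \<noteq> {}" using u by (auto simp: S_def)
    qed (rule closed, simp)+
    then have "(u, v) \<in> rtrancl_on ?V (parcs ?G)" using v unfolding S_def by blast
    then show ?thesis by (simp only: reachable_def with_proj_simps verts)
  qed
  show ?thesis
    unfolding connected_def strongly_connected_def using verts n reach by auto
qed

lemma double_fact_num_pairings: "n \<ge> 1 \<Longrightarrow> double_fact (2 * n - 1) = num_pairings n"
proof (induction n rule: dec_induct)
  case (step n)
  then have "2 * Suc n - 1 = Suc (Suc (2 * n - 1))" by simp
  then have "double_fact (2 * Suc n - 1) = Suc (Suc (2 * n - 1)) * double_fact (2 * n - 1)"
    by (simp only: double_fact.simps)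
  also have "Suc (Suc (2 * n - 1)) = 2 * n + 1" using step.hyps by simp
  finally show ?case unfolding step.IH by simp
qed simp

theorem theorem6p6:
  fixes n :: nat and \<F> :: "nat set set set"
  assumes "n \<ge> 2"
    and "\<F> \<subseteq> perfect_matchings_K (2 * n)"
    and "\<And>x y. x \<in> \<F> \<Longrightarrow> y \<in> \<F> \<Longrightarrow> \<not> Digraph_Component.connected (matching_union n x y)"
  shows "card \<F> = double_fact (2 * (n - 1) - 1) \<longleftrightarrow>
    (\<exists>i j. i \<in> {1..2 * n} \<and> j \<in> {1..2 * n} \<and> i \<noteq> j \<and> \<F> = matchings_through n i j)"
proof -
  let ?V = "{1..2 * n}"
  let ?E = "pairing_edges ?V"
  define F where "F = {p \<in> pairings ?V. ?E p \<in> \<F>}"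
  have V: "finite ?V" "card ?V = 2 * n" and n1: "n \<ge> 1" using assms(1) by simp_all
  have FE: "?E ` F = \<F>"
  proof
    show "?E ` F \<subseteq> \<F>" by (auto simp: F_def)
    show "\<F> \<subseteq> ?E ` F"
    proof
      fix x assume x: "x \<in> \<F>"
      then obtain p where "p \<in> pairings ?V" "?E p = x"
        using pairing_edges_surj[of x ?V] assms(2) by blast
      then show "x \<in> ?E ` F" using x by (auto simp: F_def)
    qed
  qed
  have inj: "inj_on ?E F"
    by (rule inj_on_subset[OF pairing_edges_inj]) (auto simp: F_def)
  have card_F: "card \<F> = card F" unfolding FE[symmetric] by (rule card_image[OF inj])
  have through: "?E ` {p \<in> pairings ?V. p i = j} = matchings_through n i j" if i: "i \<in> ?V" for i j
  proof -
    have "?E ` {p \<in> pairings ?V. p i = j} = {M \<in> ?E ` pairings ?V. {i, j} \<in> M}"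
      using pairing_edges_iff[OF _ i, of _ j] by auto
    then show ?thesis
      using pairing_edges_bij[of ?V] by (simp only: matchings_through_def bij_betw_imp_surj_on)
  qed
  have df: "double_fact (2 * (n - 1) - 1) = num_pairings (n - 1)"
    using assms(1) by (intro double_fact_num_pairings) simp
  show ?thesis
  proof
    assume "card \<F> = double_fact (2 * (n - 1) - 1)"
    then have crd: "card F = num_pairings (n - 1)" by (simp only: card_F df)
    \<comment> \<open>The case \<open>p = q\<close> is included; the union then consists of
      \<open>n \<ge> 2\<close> double edges.\<close>
    have free: "\<forall>p\<in>F. \<forall>q\<in>F. \<not> ham ?V p q"
    proof (intro ballI notI)
      fix p q assume pq: "p \<in> F" "q \<in> F" and h: "ham ?V p q"
      have "Digraph_Component.connected (matching_union n (?E p) (?E q))"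
        by (rule ham_imp_connected[OF n1 _ _ h]) (use pq in \<open>auto simp: F_def\<close>)
      moreover have "?E p \<in> \<F>" "?E q \<in> \<F>" using pq by (simp_all add: F_def)
      ultimately show False using assms(3) by blast
    qed
    have sub: "F \<subseteq> pairings ?V" by (auto simp: F_def)
    obtain a b where ab: "a \<in> ?V" "b \<in> ?V" "a \<noteq> b" and F: "F = {p \<in> pairings ?V. p a = b}"
      using ham_free_max[OF V assms(1) sub free crd] by blast
    have "\<F> = matchings_through n a b"
      unfolding FE[symmetric] through[OF ab(1), symmetric] F ..
    then show "\<exists>i j. i \<in> ?V \<and> j \<in> ?V \<and> i \<noteq> j \<and> \<F> = matchings_through n i j"
      using ab by blast
  next
    assume "\<exists>i j. i \<in> ?V \<and> j \<in> ?V \<and> i \<noteq> j \<and> \<F> = matchings_through n i j"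
    then obtain i j where ij: "i \<in> ?V" "j \<in> ?V" "i \<noteq> j" and \<F>: "\<F> = matchings_through n i j"
      by blast
    have "inj_on ?E {p \<in> pairings ?V. p i = j}"
      by (rule inj_on_subset[OF pairing_edges_inj]) auto
    then have "card \<F> = card {p \<in> pairings ?V. p i = j}"
      unfolding \<F> through[OF ij(1), symmetric] by (rule card_image)
    then show "card \<F> = double_fact (2 * (n - 1) - 1)"
      unfolding df card_through[OF V ij] .
  qed
qed

end
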